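(* Let $c$ and $e$ be the functions on Bloch sequences defined by the recursion in the context, and let $t(x)=2^{-2x}\binom{2x}{x}$ for integers $x\ge0$. Let $n\ge1$ and let $(k_1,\dots,k_n)$ be a Bloch sequence with crossing numbers $N_1,n_1,N_2,n_2,\dots,N_m,n_m$. Then $$c(k_1,\dots,k_n)=t\Big(\sum_{i=1}^m n_i\Big),$$ $$e(k_1,\dots,k_n)=\sum_{i=1}^m\left[t\Big(\sum_{l=1}^i N_l\Big)-t\Big(\sum_{l=1}^{i-1}N_l\Big)+\delta_{i,1}\right]t\Big(\sum_{j=i}^m n_j\Big).$$ That is, $c$ has the crossing property and $e$ is a function of the crossing numbers only.
   Context: A Bloch sequence of length $n\ge 0$ is a tuple $(k_1,\dots,k_n)$ of integers $k_i\ge 0$ with $\sum_{i=1}^n k_i=n$; the only one of length $0$ is the empty sequence $\emptyset$. Write $K_m=\sum_{i=1}^m k_i$ (with $K_0=0$). $\delta_{i,j}$ is the Kronecker delta. A sum whose upper limit is smaller than its lower limit is $0$, and an argument list whose initial index lies beyond its final index is empty. The functions $c$ (on Bloch sequences of length $\ge1$) and $e$ (on Bloch sequences of length $\ge0$) are the rational-valued functions uniquely determined by $c(1)=1$, $e(\emptyset)=1$ and, for every $n\ge2$, $$e(k_1,\dots,k_{n-1})=c(k_1,\dots,k_{n-1})-\sum_{m=1}^{n-2}\delta_{0,k_{n-m}}\,\delta_{n-m,K_{n-m}}\,c(0,k_1,\dots,k_{n-m-1})\,e(k_{n-m+1},\dots,k_{n-1})$$ for Bloch sequences of length $n-1$,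 and, for Bloch sequences $(k_1,\dots,k_n)$ of length $n$: - if $k_1=0$: $$c(k_1,\dots,k_n)=\sum_{m}\tfrac12\big(1-\delta_{m,K_m}-\delta_{m,K_{m+1}}\big)\,c(m-K_m,k_m,k_{m-1},\dots,k_2)\,c(K_{m+1}-m,k_{m+2},\dots,k_n),$$ the sum being over those $m\in\{1,\dots,n-1\}$ with $k_{m+1}\ge m-K_m\ge0$ (in the first factor, the entries $k_m,\dots,k_2$ are in order of decreasing index); - if $k_1=1$: $c(k_1,\dots,k_n)=c(k_2,\dots,k_n)$; - if $k_1>1$: $$c(k_1,\dots,k_n)=\sum_{m=1}^{n-1}\delta_{0,k_{n-m+1}}\,\delta_{n-m,K_{n-m}-1}\,c(k_1-1,k_2,\dots,k_{n-m})\,e(k_{n-m+2},\dots,k_n).$$ Terms whose Kronecker-delta prefactor vanishes are read as $0$ (the arguments of $c$ and $e$ in all other terms are Bloch sequences). These $c$ and $e$ are the coefficients in the expansion of the eigenvector and eigenvalue corrections in normalised nondegenerate Rayleigh-Schrödinger perturbation theory. Diagram: the diagram of $(k_1,\dots,k_n)$ is the staircase path from $(0,0)$ to $(n,n)$ whose $i$-th step goes up by $k_i$ and then right by $1$. The main diagonal is $y=x$ and the upper diagonal is $y=x+1$. Crossing numbers: reading the diagram in order, it crosses above the upper diagonal $N_1$ times, then below the main diagonal $n_1$ times, then above the upper diagonal $N_2$ times, and so on; $N_1$ and $n_m$ may be $0$, all other crossing numbers are strictly positive. Precisely, they are given by the following procedure. Start with $m=1$, $N_1=n_1=0$, and flag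 $x=1$. For $i=1,\dots,n$ in order: (i) if $K_i>i$ and $K_{i-1}\le i-1$: first, if $x\neq1$, increase $m$ by $1$, set $N_m=n_m=0$ and $x=1$; then (in either case) increase $N_m$ by $1$; (ii) else, if $K_i<i$ and $K_{i-1}\ge i-1$: increase $n_m$ by $1$ and set $x=0$. The crossing numbers are the final $N_1,n_1,\dots,N_m,n_m$. Crossing property: let $x(k_1,\dots,k_n)$ be the number of times the diagram intersects the main diagonal (i.e. passes from one side of it to the other; touching it without changing sides, and the start and end points, are not counted). A function $f$ on Bloch sequences has the crossing property if there is a function $g$ with $f(k_1,\dots,k_n)=g(\lceil x(k_1,\dots,k_n)/2\rceil)$ for all Bloch sequences, i.e. $f$ depends only on the number of times the diagram crosses from below to above the main diagonal. *)

theory Defs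
  imports Complex_Main
begin

definition bloch_seq :: "nat list \<Rightarrow> bool" where
  "bloch_seq ks \<longleftrightarrow> sum_list ks = length ks"

text \<open>The entries of a sequence \<open>ks\<close> are indexed from 1, so \<open>entry ks i\<close> is $k_i$ and
  \<open>psum ks m\<close> is $K_m$; \<open>slice ks a b\<close> is the argument list $k_a,\dots,k_b$, which is empty
  for \<open>a > b\<close>.\<close>

definition entry :: "nat list \<Rightarrow> nat \<Rightarrow> nat" where
  "entry ks i = ks ! (i - 1)"

definition psum :: "nat list \<Rightarrow> nat \<Rightarrow> nat" where
  "psum ks m = (\<Sum>i=1..m. entry ks i)"

definition slice :: "nat list \<Rightarrow> nat \<Rightarrow> nat \<Rightarrow> nat list" where
  "slice ks a b = map (entry ks) [a..<Suc b]"

lemma length_slice [simp]: "length (slice ks a b) = Suc b - a"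
  unfolding slice_def length_map length_upt ..

definition kdelta :: "nat \<Rightarrow> nat \<Rightarrow> rat" where
  "kdelta i j = (if i = j then 1 else 0)"

text \<open>Both functions are total on lists, but only their values on Bloch sequences are meaningful.
  A summand whose Kronecker delta prefactor vanishes is 0 whatever the value of its other factors.
  With respect to the usual presentation, \<open>bloch_e\<close> is stated for a sequence of length
  \<open>n\<close> instead of \<open>n - 1\<close>. No subtraction is truncated in a nonvanishing summand; in the case
  $k_1 > 1$ the condition $K_{n-m} - 1 = n - m$ is written additively.\<close>

function bloch_c :: "nat list \<Rightarrow> rat" and bloch_e :: "nat list \<Rightarrow> rat" where
  "bloch_c ks =
    (let n = length ks; k = entry ks; K = psum ks in
     if n \<le> 1 then (if ks = [1] then 1 else 0)
     else if k 1 = 0 then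
       (\<Sum>m\<in>{m\<in>{1..n - 1}. K m \<le> m \<and> m - K m \<le> k (m + 1)}.
          1 / 2 * (1 - kdelta m (K m) - kdelta m (K (m + 1))) *
          bloch_c ((m - K m) # rev (slice ks 2 m)) *
          bloch_c ((K (m + 1) - m) # slice ks (m + 2) n))
     else if k 1 = 1 then bloch_c (slice ks 2 n)
     else
       (\<Sum>m=1..n - 1.
          kdelta 0 (k (n - m + 1)) * kdelta (n - m + 1) (K (n - m)) *
          bloch_c ((k 1 - 1) # slice ks 2 (n - m)) *
          bloch_e (slice ks (n - m + 2) n)))"
| "bloch_e ks =
    (let n = length ks; k = entry ks; K = psum ks in
     if n = 0 then 1
     else bloch_c ks -
       (\<Sum>m=1..n - 1.
          kdelta 0 (k (n + 1 - m)) * kdelta (n + 1 - m) (K (n + 1 - m)) *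
          bloch_c (0 # slice ks 1 (n - m)) *
          bloch_e (slice ks (n - m + 2) n)))"
  by pat_completeness auto
termination
  by (relation "measure (case_sum (\<lambda>ks. 2 * length ks) (\<lambda>ks. 2 * length ks + 1))") auto

declare bloch_c.simps [simp del] bloch_e.simps [simp del]

text \<open>One step of the procedure computing the crossing numbers, acting on a state
  \<open>(m, N, n, x)\<close>.\<close>

type_synonym crossing_state = "nat \<times> (nat \<Rightarrow> nat) \<times> (nat \<Rightarrow> nat) \<times> nat"

fun crossing_step :: "nat list \<Rightarrow> nat \<Rightarrow> crossing_state \<Rightarrow> crossing_state" where
  "crossing_step ks i (m, N, n, x) =
    (if psum ks i > i \<and> psum ks (i - 1) \<le> i - 1 then
       (let (m', N', n', x') =
          (if x \<noteq> 1 then (m + 1, N(m + 1 := 0), n(m + 1 := 0), 1) else (m, N, n, x))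
        in (m', N'(m' := N' m' + 1), n', x'))
     else if psum ks i < i \<and> psum ks (i - 1) \<ge> i - 1 then
       (m, N, n(m := n m + 1), 0)
     else (m, N, n, x))"

definition crossing_result :: "nat list \<Rightarrow> crossing_state" where
  "crossing_result ks =
    fold (crossing_step ks) [1..<Suc (length ks)] (1, (\<lambda>_. 0), (\<lambda>_. 0), 1)"

definition num_blocks :: "nat list \<Rightarrow> nat" where
  "num_blocks ks = (case crossing_result ks of (m, N, n, x) \<Rightarrow> m)"

definition upper_crossings :: "nat list \<Rightarrow> nat \<Rightarrow> nat" where
  "upper_crossings ks = (case crossing_result ks of (m, N, n, x) \<Rightarrow> N)"

definition lower_crossings :: "nat list \<Rightarrow> nat \<Rightarrow> nat" where
  "lower_crossings ks = (case crossing_result ks of (m, N, n, x) \<Rightarrow> n)"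

definition crossing_numbers :: "nat list \<Rightarrow> (nat \<times> nat) list" where
  "crossing_numbers ks =
    map (\<lambda>i. (upper_crossings ks i, lower_crossings ks i)) [1..<Suc (num_blocks ks)]"

text \<open>The vertices of the staircase path after the origin, as pairs (abscissa, ordinate). An upward
  step may pass through the main diagonal between two vertices, but a step to the right has length 1
  and cannot, and two vertices on opposite sides of the diagonal may be separated by vertices on it.
  So the passages from one side to the other are the sign changes of the ordinate minus the abscissa
  along the vertices lying off the diagonal.\<close>

definition diagram :: "nat list \<Rightarrow> (nat \<times> nat) list" where
  "diagram ks = concat (map (\<lambda>i. [(i - 1, psum ks i), (i, psum ks i)]) [1..<Suc (length ks)])"

definition off_diagonal :: "nat list \<Rightarrow> int list" where
  "off_diagonal ks = filter (\<lambda>d. d \<noteq> 0) (map (\<lambda>(x, y). int y - int x) (diagram ks))"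

definition diagonal_crossings :: "nat list \<Rightarrow> nat" where
  "diagonal_crossings ks =
    card {j. Suc j < length (off_diagonal ks) \<and>
      sgn (off_diagonal ks ! j) \<noteq> sgn (off_diagonal ks ! Suc j)}"

text \<open>The set \<open>A\<close> is the domain of \<open>f\<close>.\<close>

definition crossing_property_on :: "nat list set \<Rightarrow> (nat list \<Rightarrow> rat) \<Rightarrow> bool" where
  "crossing_property_on A f \<longleftrightarrow>
    (\<exists>g :: int \<Rightarrow> rat. \<forall>ks\<in>A. f ks = g \<lceil>of_nat (diagonal_crossings ks) / (2 :: rat)\<rceil>)"

definition t :: "nat \<Rightarrow> rat" where
  "t x = of_nat ((2 * x) choose x) / 2 ^ (2 * x)"

end

theory Submission
  imports Defs
begin

text \<open>Write $d_i = K_i - i$. Up to the Kronecker deltas, each recursion cuts the diagram at a point of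
  the main or the upper diagonal, possibly rotating the first piece by 180 degrees, and the pieces
  are again diagrams. If $b$ is the number of times $d$ drops below 0, then $c = t(b)$. For
  $k_1 = 0$, a cut where the diagram rises through the diagonal contributes $\frac12 t(j) t(b-1-j)$
  and one where it falls $-\frac12 t(j) t(b-j)$ with $0 < j < b$, so this case is an instance of
  $\sum_{j=0}^{b} t(j) t(b-j) = 1$.

  The formula for $e$ is equivalent to a sum over the descents of $d$ below 1: if the $a$-th descent
  has $b_a$ drops below 0 after it, then
  $e = t(b) + \sum_a (t(a) - t(a-1)) t(b_a)$. In this form, the remaining recursions (whose cuts
  are exactly these descents) again reduce to the convolution identity after exchanging two sums.\<close>

subsection \<open>The convolution identity\<close>

lemma t_0 [simp]: "t 0 = 1"
  by (simp add: t_def)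

text \<open>The ratio of consecutive central binomial coefficients, from
  \<open>(2 n)! / (n!)^2\<close>. Stated without division, it turns a sum weighted by
  \<open>i\<close> into one shifted by one.\<close>

lemma t_Suc: "of_nat (2 * Suc n) * t (Suc n) = of_nat (2 * n + 1) * t n"
proof -
  have diff: "2 * m - m = m" for m :: nat by simp
  have central: "of_nat ((2 * m) choose m) = fact (2 * m) / (fact m * fact m :: rat)" for m
    using binomial_fact[of m "2 * m", where 'a = rat] unfolding diff by simp
  have "2 * Suc n = Suc (Suc (2 * n))" "of_nat (Suc (Suc (2 * n))) = 2 * (of_nat (Suc n) :: rat)"
    "of_nat (Suc (2 * n)) = (of_nat (2 * n + 1) :: rat)"
    by simp_all
  then have dbl: "fact (2 * Suc n) = 2 * of_nat (Suc n) * (of_nat (2 * n + 1) * fact (2 * n) :: rat)"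
    by (simp only: fact_Suc mult.assoc)
  \<comment> \<open>Abstract form of the cancellation, with \<open>N\<close> = n + 1,
    \<open>M\<close> = 2n + 1, \<open>F\<close> = (2n)!, \<open>f\<close> = n! and \<open>p\<close>
    = 2^(2n).\<close>
  have alg: "2 * N * (2 * N * (M * F) / (N * f * (N * f)) / (4 * p)) = M * (F / (f * f) / p)"
    if "N \<noteq> 0" "f \<noteq> 0" "p \<noteq> 0" for N M F f p :: rat
    using that by (simp add: field_simps)
  have "of_nat (2 * Suc n) = 2 * (of_nat (Suc n) :: rat)" "(2::rat) ^ (2 * Suc n) = 4 * 2 ^ (2 * n)"
    by simp_all
  then show ?thesis
    unfolding t_def central dbl fact_Suc[of n] by (simp only:) (rule alg; simp)
qed

text \<open>The \<open>t i\<close> are the coefficients of (1 - z)^(-1/2), whose square is 1/(1 -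
  z). The induction avoids power series: multiplying by \<open>Suc n\<close> and using the symmetry
  of the sum leaves twice the sum weighted by \<open>i\<close>, which \<open>t_Suc\<close> reduces
  to the case \<open>n\<close>.\<close>

lemma t_convolution: "(\<Sum>i\<le>n. t i * t (n - i)) = 1"
proof (induction n)
  case (Suc n)
  have rev: "(\<Sum>i\<le>Suc n. of_nat (Suc n - i) * t i * t (Suc n - i)) = (\<Sum>i\<le>Suc n. of_nat i * t i * t (Suc n - i))"
    by (subst sum.nat_diff_reindex[symmetric, where n = "Suc (Suc n)", unfolded lessThan_Suc_atMost])
      (auto intro!: sum.cong)
  have revn: "(\<Sum>i\<le>n. of_nat (n - i) * t i * t (n - i)) = (\<Sum>i\<le>n. of_nat i * t i * t (n - i))"
    by (subst sum.nat_diff_reindex[symmetric, where n = "Suc n", unfolded lessThan_Suc_atMost])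
      (auto intro!: sum.cong)
  have dbl: "of_nat k * (\<Sum>i\<le>k. t i * t (k - i)) = (\<Sum>i\<le>k. of_nat (k - i) * t i * t (k - i)) + (\<Sum>i\<le>k. of_nat i * t i * t (k - i))" for k
    unfolding sum_distrib_left sum.distrib[symmetric]
    by (intro sum.cong) (auto simp: of_nat_diff algebra_simps)
  have "of_nat (Suc n) * (\<Sum>i\<le>Suc n. t i * t (Suc n - i)) = 2 * (\<Sum>i\<le>Suc n. of_nat i * t i * t (Suc n - i))"
    unfolding dbl rev by simp
  also have "\<dots> = (\<Sum>i\<le>n. of_nat (2 * Suc i) * t (Suc i) * t (n - i))"
    unfolding sum.atMost_Suc_shift sum_distrib_left by (simp add: sum_distrib_left algebra_simps)
  also have "\<dots> = (\<Sum>i\<le>n. of_nat (2 * i + 1) * t i * t (n - i))"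
    by (simp only: t_Suc)
  also have "\<dots> = of_nat n * (\<Sum>i\<le>n. t i * t (n - i)) + (\<Sum>i\<le>n. t i * t (n - i))"
    unfolding dbl revn by (simp add: sum.distrib[symmetric] algebra_simps)
  also have "\<dots> = of_nat (Suc n)"
    using Suc.IH by simp
  finally show ?case
    by (simp del: of_nat_Suc)
qed simp

subsection \<open>Falls of a predicate along the naturals\<close>

text \<open>A fall is recorded at its later index, and the interval is half-open, so that counts
  over adjacent intervals add up.\<close>

definition falls :: "(nat \<Rightarrow> bool) \<Rightarrow> nat \<Rightarrow> nat \<Rightarrow> nat set" where
  "falls R a b = {i\<in>{a<..b}. R (i - 1) \<and> \<not> R i}"

definition num_falls :: "(nat \<Rightarrow> bool) \<Rightarrow> nat \<Rightarrow> nat \<Rightarrow> nat" where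
  "num_falls R a b = card (falls R a b)"

lemma finite_falls [simp]: "finite (falls R a b)"
  by (simp add: falls_def)

lemma num_falls_same [simp]: "num_falls R a a = 0"
  by (simp add: num_falls_def falls_def)

lemma falls_Suc:
  "a \<le> b \<Longrightarrow> falls R a (Suc b) = (if R b \<and> \<not> R (Suc b) then insert (Suc b) (falls R a b) else falls R a b)"
  by (auto simp: falls_def le_Suc_eq)

lemma Suc_notin_falls [simp]: "Suc b \<notin> falls R a b"
  by (simp add: falls_def)

lemma num_falls_Suc:
  "a \<le> b \<Longrightarrow> num_falls R a (Suc b) = num_falls R a b + of_bool (R b \<and> \<not> R (Suc b))"
  by (simp add: num_falls_def falls_Suc)

lemma num_falls_split:
  assumes "a \<le> b" "b \<le> c"
  shows "num_falls R a c = num_falls R a b + num_falls R b c"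
proof -
  have "falls R a c = falls R a b \<union> falls R b c" "falls R a b \<inter> falls R b c = {}"
    using assms by (auto simp: falls_def)
  then show ?thesis by (simp add: num_falls_def card_Un_disjoint)
qed

lemma falls_shift:
  assumes R: "\<And>j. a \<le> j \<Longrightarrow> j \<le> b \<Longrightarrow> R' j = R (j + s)"
  shows "falls R (a + s) (b + s) = (\<lambda>i. i + s) ` falls R' a b"
proof -
  have iff: "i + s \<in> falls R (a + s) (b + s) \<longleftrightarrow> i \<in> falls R' a b" for i
    using R[of i] R[of "i - 1"] by (auto simp: falls_def)
  have "i \<in> (\<lambda>i. i + s) ` {i. i + s \<in> falls R (a + s) (b + s)}" if "i \<in> falls R (a + s) (b + s)" for i
    using that by (intro image_eqI[of _ _ "i - s"]) (auto simp: falls_def)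
  then show ?thesis using iff by blast
qed

lemma num_falls_shift:
  assumes R: "\<And>j. a \<le> j \<Longrightarrow> j \<le> b \<Longrightarrow> R' j = R (j + s)"
  shows "num_falls R' a b = num_falls R (a + s) (b + s)"
proof -
  have "falls R (a + s) (b + s) = (\<lambda>i. i + s) ` falls R' a b"
    by (rule falls_shift) (rule R)
  then show ?thesis by (simp add: num_falls_def card_image)
qed

text \<open>Reversing the order turns falls into rises and negating turns them back: the fall at
  \<open>i\<close> matches the one at \<open>s + 1 - i\<close>. This handles the piece rotated by
  180 degrees.\<close>

lemma num_falls_reflect:
  assumes "\<And>j. a \<le> j \<Longrightarrow> j \<le> b \<Longrightarrow> R' j = (\<not> R (s - j))" and "b \<le> s"
  shows "num_falls R' a b = num_falls R (s - b) (s - a)"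
proof -
  have "bij_betw (\<lambda>i. s + 1 - i) (falls R' a b) (falls R (s - b) (s - a))"
  proof (intro bij_betw_byWitness[where f' = "\<lambda>i. s + 1 - i"] image_subsetI)
    fix i assume i: "i \<in> falls R' a b"
    then have *: "a < i" "i \<le> b" "R' (i - 1)" "\<not> R' i"
      by (auto simp: falls_def)
    have "R' (i - 1) = (\<not> R (s - (i - 1)))" "R' i = (\<not> R (s - i))"
      by (rule assms(1); use * in simp)+
    moreover have "s - (i - 1) = s + 1 - i" "s - i = s + 1 - i - 1"
      using * assms(2) by auto
    ultimately have "R (s + 1 - i - 1)" "\<not> R (s + 1 - i)"
      using *(3,4) by metis+
    then show "s + 1 - i \<in> falls R (s - b) (s - a)"
      using *(1,2) assms(2) unfolding falls_def by auto
  next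
    fix i assume "i \<in> falls R (s - b) (s - a)"
    then have *: "s - b < i" "i \<le> s - a" "R (i - 1)" "\<not> R i"
      by (auto simp: falls_def)
    have "R' (s + 1 - i) = (\<not> R (s - (s + 1 - i)))" "R' (s + 1 - i - 1) = (\<not> R (s - (s + 1 - i - 1)))"
      by (rule assms(1); use * in simp)+
    moreover have "s - (s + 1 - i) = i - 1" "s - (s + 1 - i - 1) = i"
      using * assms(2) by auto
    ultimately have "R' (s + 1 - i - 1)" "\<not> R' (s + 1 - i)"
      using *(3,4) by metis+
    then show "s + 1 - i \<in> falls R' a b"
      using *(1,2) assms(2) unfolding falls_def by auto
  qed (use assms(2) in \<open>auto simp: falls_def\<close>)
  then show ?thesis by (simp add: num_falls_def bij_betw_same_card)
qed

lemma num_falls_one: "num_falls R 0 (Suc 0) = of_bool (R 0 \<and> \<not> R (Suc 0))"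
  using num_falls_Suc[of 0 0 R] by simp

lemma num_falls_from_1:
  "1 \<le> b \<Longrightarrow> num_falls R 0 b = of_bool (R 0 \<and> \<not> R 1) + num_falls R 1 b"
  using num_falls_split[of 0 1 b R] by (simp add: num_falls_one)

text \<open>Falls of the negation are rises. Falls and rises alternate, a fall coming first.\<close>

lemma num_falls_alternate:
  "R 0 \<Longrightarrow> num_falls R 0 j = num_falls (\<lambda>i. \<not> R i) 0 j + of_bool (\<not> R j)"
  by (induction j) (auto simp: num_falls_Suc)

lemma num_falls_at_fall:
  "i \<in> falls R 0 n \<Longrightarrow> num_falls R 0 i = Suc (num_falls R 0 (i - 1))"
  using num_falls_Suc[of 0 "i - 1" R] by (auto simp: falls_def)

text \<open>The number of earlier falls ranks the falls 0, 1, 2, ... without gaps or repetition, so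
  a sum depending only on rank is an ordinary finite sum.\<close>

lemma sum_over_falls:
  "(\<Sum>i\<in>falls R 0 n. f (num_falls R 0 (i - 1))) = (\<Sum>j<num_falls R 0 n. f j)"
proof (induction n)
  case (Suc n)
  then show ?case
    by (auto simp: num_falls_Suc falls_Suc add.commute)
qed (simp add: falls_def)

text \<open>For \<open>P i\<close> meaning $K_i \ge i$ and \<open>Q i\<close> meaning $K_i > i$, this is the value of $e$ on
  the part of the diagram after abscissa \<open>a\<close>.\<close>

definition crossing_weight :: "(nat \<Rightarrow> bool) \<Rightarrow> (nat \<Rightarrow> bool) \<Rightarrow> nat \<Rightarrow> nat \<Rightarrow> rat" where
  "crossing_weight P Q a n =
    t (num_falls P a n) + (\<Sum>i\<in>falls Q a n. (t (num_falls Q a i) - t (num_falls Q a (i - 1))) * t (num_falls P i n))"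

lemma crossing_weight_shift:
  assumes "\<And>j. j \<le> n \<Longrightarrow> P' j = P (j + s)" "\<And>j. j \<le> n \<Longrightarrow> Q' j = Q (j + s)"
  shows "crossing_weight P' Q' 0 n = crossing_weight P Q s (n + s)"
proof -
  have Q: "falls Q s (n + s) = (\<lambda>i. i + s) ` falls Q' 0 n"
    using falls_shift[of 0 n Q' Q s] assms by simp
  have nQ: "num_falls Q' 0 i = num_falls Q s (i + s)" if "i \<le> n" for i
    using num_falls_shift[of 0 i Q' Q s] assms that by simp
  have nP: "num_falls P' i n = num_falls P (i + s) (n + s)" for i
    using num_falls_shift[of i n P' P s] assms by simp
  have "(\<Sum>i\<in>falls Q s (n + s). (t (num_falls Q s i) - t (num_falls Q s (i - 1))) * t (num_falls P i (n + s)))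
    = (\<Sum>i\<in>falls Q' 0 n. (t (num_falls Q' 0 i) - t (num_falls Q' 0 (i - 1))) * t (num_falls P' i n))"
    unfolding Q by (subst sum.reindex) (auto intro!: sum.cong simp: nQ nP falls_def)
  then show ?thesis
    using nP[of 0] by (simp add: crossing_weight_def)
qed

text \<open>Expanding the weight gives a double sum over falls \<open>i < k\<close> of
  \<open>Q\<close>. Exchanging the sums collects all terms with the same
  \<open>t (num_falls P k n)\<close>, and the inner sum depends on \<open>k\<close> only through its
  rank \<open>J\<close>. The term \<open>f J\<close> comes from \<open>i = k\<close>.\<close>

lemma sum_falls_crossing_weight:
  "(\<Sum>i\<in>falls Q 0 n. f (num_falls Q 0 (i - 1)) * crossing_weight P Q i n) =
   (\<Sum>k\<in>falls Q 0 n. t (num_falls P k n) *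
      (let J = num_falls Q 0 (k - 1) in f J + (\<Sum>I<J. f I * (t (J - I) - t (J - Suc I)))))"
proof -
  let ?X = "falls Q 0 n" and ?f = "\<lambda>i. f (num_falls Q 0 (i - 1))"
  let ?g = "\<lambda>i k. (t (num_falls Q i k) - t (num_falls Q i (k - 1))) * t (num_falls P k n)"
  have sub: "falls Q i n = {k\<in>?X. i < k}" for i
    by (auto simp: falls_def)
  have "(\<Sum>i\<in>?X. ?f i * crossing_weight P Q i n) =
      (\<Sum>i\<in>?X. ?f i * t (num_falls P i n)) + (\<Sum>i\<in>?X. \<Sum>k\<in>?X. if i < k then ?f i * ?g i k else 0)"
    unfolding sum.distrib[symmetric]
  proof (rule sum.cong)
    fix i
    have "(\<Sum>k\<in>falls Q i n. ?g i k) = (\<Sum>k\<in>?X. if i < k then ?g i k else 0)"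
      unfolding sub[of i] by (simp add: sum.inter_filter cong: if_cong)
    then show "?f i * crossing_weight P Q i n =
        ?f i * t (num_falls P i n) + (\<Sum>k\<in>?X. if i < k then ?f i * ?g i k else 0)"
      unfolding crossing_weight_def by (auto simp: distrib_left sum_distrib_left intro!: sum.cong)
  qed simp
  also have "(\<Sum>i\<in>?X. \<Sum>k\<in>?X. if i < k then ?f i * ?g i k else 0) =
      (\<Sum>k\<in>?X. \<Sum>i\<in>?X. if i < k then ?f i * ?g i k else 0)"
    by (rule sum.swap)
  also have "\<dots> = (\<Sum>k\<in>?X. t (num_falls P k n) *
      (let J = num_falls Q 0 (k - 1) in \<Sum>I<J. f I * (t (J - I) - t (J - Suc I))))"
  proof (rule sum.cong)
    fix k assume k: "k \<in> ?X"
    let ?J = "num_falls Q 0 (k - 1)"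
    have X: "{i\<in>?X. i < k} = falls Q 0 (k - 1)"
      using k by (auto simp: falls_def)
    have "(\<Sum>i\<in>?X. if i < k then ?f i * ?g i k else 0) = (\<Sum>i\<in>falls Q 0 (k - 1). ?f i * ?g i k)"
      unfolding X[symmetric] by (rule sum.inter_filter[symmetric]) simp
    also have "\<dots> = (\<Sum>i\<in>falls Q 0 (k - 1).
        (\<lambda>I. t (num_falls P k n) * (f I * (t (?J - I) - t (?J - Suc I)))) (num_falls Q 0 (i - 1)))"
    proof (rule sum.cong)
      fix i assume i: "i \<in> falls Q 0 (k - 1)"
      then have ik: "i \<le> k - 1" "i \<le> k" by (auto simp: falls_def)
      \<comment> \<open>With \<open>I\<close> the rank of \<open>i\<close>, the falls up to
        \<open>i\<close> number \<open>I + 1\<close> and those up to \<open>k\<close> number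
        \<open>J + 1\<close>; stopping at \<open>k - 1\<close> loses the fall at
        \<open>k\<close>.\<close>
      have "num_falls Q i k = ?J - num_falls Q 0 (i - 1)" "num_falls Q i (k - 1) = ?J - Suc (num_falls Q 0 (i - 1))"
        using num_falls_split[of 0 i "k - 1" Q] num_falls_split[of 0 i k Q] ik
          num_falls_at_fall[OF i] num_falls_at_fall[OF k] by auto
      then show "?f i * ?g i k = (\<lambda>I. t (num_falls P k n) * (f I * (t (?J - I) - t (?J - Suc I)))) (num_falls Q 0 (i - 1))"
        by simp
    qed simp
    also have "\<dots> = (\<Sum>I<?J. t (num_falls P k n) * (f I * (t (?J - I) - t (?J - Suc I))))"
      by (rule sum_over_falls)
    finally show "(\<Sum>i\<in>?X. if i < k then ?f i * ?g i k else 0) = t (num_falls P k n) *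
      (let J = ?J in \<Sum>I<J. f I * (t (J - I) - t (J - Suc I)))"
      unfolding Let_def sum_distrib_left .
  qed simp
  finally show ?thesis
    by (simp add: Let_def distrib_left sum.distrib mult.commute)
qed

section \<open>Evaluation of the sums in the three recursions\<close>

lemma t_convolution_less: "(\<Sum>I<J. t I * t (J - Suc I)) = of_bool (0 < J)"
  using t_convolution[of "J - 1"]
  by (cases J) (simp_all add: lessThan_Suc_atMost)

text \<open>The inner sum of \<open>sum_falls_crossing_weight\<close> for \<open>f = t\<close>: a
  difference of two complete convolutions, which cancel unless the second is empty.\<close>

lemma t_convolution_diff:
  "t J + (\<Sum>I<J. t I * (t (J - I) - t (J - Suc I))) = of_bool (J = 0)"
proof -
  have "t J + (\<Sum>I<J. t I * t (J - I)) = 1"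
    using t_convolution[of J] by (simp add: lessThan_Suc_atMost[symmetric])
  then show ?thesis
    using t_convolution_less[of J] by (simp add: right_diff_distrib sum_subtractf)
qed

lemma t_convolution_Suc: "(\<Sum>I<J. t (Suc I) * t (J - Suc I)) = 1 - t J"
  using t_convolution[of J] by (simp only: lessThan_Suc_atMost[symmetric] sum.lessThan_Suc_shift) simp

text \<open>The inner sum for the weight \<open>t (Suc I)\<close>. Both convolutions now lack their
  first term, and the difference of the missing terms remains.\<close>

lemma t_convolution_Suc_diff:
  "t (Suc J) + (\<Sum>I<J. t (Suc I) * (t (J - I) - t (J - Suc I))) = t J - t (Suc J)"
  using t_convolution_Suc[of J] t_convolution_Suc[of "Suc J"]
  by (simp add: right_diff_distrib sum_subtractf)

text \<open>Abstract form of the recursion for \<open>bloch_e\<close>. After the exchange of sums,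
  each fall of \<open>Q\<close> of rank \<open>J\<close> carries \<open>t J - t (Suc J)\<close>, the
  negative of its coefficient in \<open>crossing_weight\<close>.\<close>

lemma crossing_weight_recursion:
  "crossing_weight P Q 0 n =
    t (num_falls P 0 n) - (\<Sum>i\<in>falls Q 0 n. t (Suc (num_falls Q 0 (i - 1))) * crossing_weight P Q i n)"
proof -
  have "(\<Sum>i\<in>falls Q 0 n. (t (num_falls Q 0 i) - t (num_falls Q 0 (i - 1))) * t (num_falls P i n))
      = - (\<Sum>i\<in>falls Q 0 n. t (num_falls P i n) * (t (num_falls Q 0 (i - 1)) - t (Suc (num_falls Q 0 (i - 1)))))"
    unfolding sum_negf[symmetric]
  proof (rule sum.cong)
    fix i assume "i \<in> falls Q 0 n"
    from num_falls_at_fall[OF this]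
    show "(t (num_falls Q 0 i) - t (num_falls Q 0 (i - 1))) * t (num_falls P i n)
        = - (t (num_falls P i n) * (t (num_falls Q 0 (i - 1)) - t (Suc (num_falls Q 0 (i - 1)))))"
      by (simp only:) (simp add: algebra_simps)
  qed simp
  then show ?thesis
    unfolding sum_falls_crossing_weight[where f = "\<lambda>j. t (Suc j)"] Let_def t_convolution_Suc_diff
    unfolding crossing_weight_def by simp
qed

lemma no_falls: "(\<And>i. a \<le> i \<Longrightarrow> i \<le> b \<Longrightarrow> R i) \<Longrightarrow> num_falls R a b = 0"
  by (auto simp: num_falls_def falls_def)

lemma num_falls_0_imp:
  "num_falls R a b = 0 \<Longrightarrow> R a \<Longrightarrow> a \<le> i \<Longrightarrow> i \<le> b \<Longrightarrow> R i"
proof (induction i)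
  case (Suc i)
  show ?case
  proof (cases "a = Suc i")
    case False
    then have "R i" using Suc by auto
    moreover have "Suc i \<notin> falls R a b" using Suc.prems(1) by (simp add: num_falls_def)
    ultimately show ?thesis using Suc.prems False by (auto simp: falls_def)
  qed (use Suc in auto)
qed simp

text \<open>Abstract form of the case \<open>1 < entry ks 1\<close>. By
  \<open>t_convolution_diff\<close> only the first fall of \<open>Q\<close> survives the exchange of
  sums. No fall of \<open>P\<close> precedes it, so its factor already counts all falls of
  \<open>P\<close>.\<close>

lemma sum_falls_crossing_weight_eq_t:
  assumes QP: "\<And>i. i < n \<Longrightarrow> Q i \<Longrightarrow> P i" "\<And>i. i < n \<Longrightarrow> Q i \<Longrightarrow> P (Suc i)"
    and P0: "P 0" and Q: "\<not> Q 0" "Q 1" "\<not> Q n" and n: "1 \<le> n"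
  shows "(\<Sum>i\<in>falls Q 0 n. t (num_falls Q 0 (i - 1)) * crossing_weight P Q i n) = t (num_falls P 0 n)"
proof -
  have first: "num_falls P 0 k = 0" if "k \<in> falls Q 0 n" "num_falls Q 0 (k - 1) = 0" for k
  proof (rule no_falls)
    fix i assume i: "0 \<le> i" "i \<le> k"
    have "k \<noteq> 1" using that(1) Q by (auto simp: falls_def)
    moreover have "0 < k" "k \<le> n" using that(1) by (auto simp: falls_def)
    ultimately have k: "1 \<le> k - 1" "k \<le> n" by auto
    have "num_falls Q 1 (k - 1) = 0" using that(2) num_falls_split[of 0 1 "k - 1" Q] k by simp
    then have "Q j" if "1 \<le> j" "j \<le> k - 1" for j
      using num_falls_0_imp[of Q 1 "k - 1" j] Q that by simp
    \<comment> \<open>At \<open>i = k\<close>, where \<open>Q\<close> has already failed,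
      \<open>P\<close> comes from \<open>Q (k - 1)\<close>.\<close>
    then show "P i" using QP(1)[of i] QP(2)[of "i - 1"] P0 k i
      by (cases "i = 0"; cases "i = k") auto
  qed
  \<comment> \<open>\<open>Q\<close> holds at 1 and fails at \<open>n\<close>, so a first fall
    exists.\<close>
  have pos: "num_falls Q 0 n \<noteq> 0"
    using num_falls_0_imp[of Q 1 n n] Q n num_falls_from_1[OF n, of Q] by auto
  have "(\<Sum>i\<in>falls Q 0 n. t (num_falls Q 0 (i - 1)) * crossing_weight P Q i n)
    = (\<Sum>k\<in>falls Q 0 n. t (num_falls P k n) * of_bool (num_falls Q 0 (k - 1) = 0))"
    unfolding sum_falls_crossing_weight Let_def t_convolution_diff ..
  also have "\<dots> = (\<Sum>k\<in>falls Q 0 n. (\<lambda>j. t (num_falls P 0 n) * of_bool (j = 0)) (num_falls Q 0 (k - 1)))"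
  proof (rule sum.cong)
    fix k assume k: "k \<in> falls Q 0 n"
    then have "k \<le> n" by (auto simp: falls_def)
    then show "t (num_falls P k n) * of_bool (num_falls Q 0 (k - 1) = 0) =
       (\<lambda>j. t (num_falls P 0 n) * of_bool (j = 0)) (num_falls Q 0 (k - 1))"
      using first[OF k] num_falls_split[of 0 k n P] by (cases "num_falls Q 0 (k - 1) = 0") simp_all
  qed simp
  also have "\<dots> = (\<Sum>j<num_falls Q 0 n. t (num_falls P 0 n) * of_bool (j = 0))"
    by (rule sum_over_falls)
  finally show ?thesis
    using pos by (simp add: of_bool_def if_distrib sum.delta cong: if_cong)
qed

text \<open>Abstract form of the case \<open>entry ks 1 = 0\<close>. The rises sum to 1/2. The falls
  after the first sum to half of a convolution without its two end terms, that is 1/2 -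
  \<open>t x\<close>.\<close>

lemma crossing_sum_eq_t:
  assumes R: "R 0" "\<not> R 1" "R n" and n: "1 \<le> n"
  defines "x \<equiv> num_falls R 0 n"
  shows "(\<Sum>i\<in>falls (\<lambda>i. \<not> R i) 1 n. 1 / 2 * t (num_falls R 0 (i - 1) - 1) * t (num_falls R (i - 1) n))
       - (\<Sum>i\<in>falls R 1 n. 1 / 2 * t (num_falls R 0 (i - 1)) * t (num_falls R (i - 1) n)) = t x"
proof -
  let ?S = "\<lambda>i. \<not> R i"
  have x: "num_falls ?S 0 n = x" using num_falls_alternate[of R n] R by (simp add: x_def)
  have x0: "0 < x" using num_falls_from_1[OF n, of R] R by (simp add: x_def)
  have tail: "num_falls R (i - 1) n = x - num_falls R 0 (i - 1)" if "i \<le> n" for i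
    using num_falls_split[of 0 "i - 1" n R] that by (simp add: x_def)
  \<comment> \<open>There is no rise at 1, so counting may start at 0, as
    \<open>sum_over_falls\<close> requires.\<close>
  have S: "falls ?S 1 n = falls ?S 0 n"
    using R by (auto simp: falls_def) (metis One_nat_def Suc_lessI diff_Suc_1)
  have "(\<Sum>i\<in>falls ?S 1 n. 1 / 2 * t (num_falls R 0 (i - 1) - 1) * t (num_falls R (i - 1) n))
     = (\<Sum>i\<in>falls ?S 0 n. (\<lambda>j. 1 / 2 * (t j * t (x - Suc j))) (num_falls ?S 0 (i - 1)))"
    unfolding S
  proof (rule sum.cong)
    fix i assume i: "i \<in> falls ?S 0 n"
    \<comment> \<open>Just before a rise there has been one more fall than rises, so the subtraction
      of 1 is not truncated.\<close>
    then have "num_falls R 0 (i - 1) = Suc (num_falls ?S 0 (i - 1))"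
      using num_falls_alternate[of R "i - 1"] R by (auto simp: falls_def)
    then show "1 / 2 * t (num_falls R 0 (i - 1) - 1) * t (num_falls R (i - 1) n)
       = (\<lambda>j. 1 / 2 * (t j * t (x - Suc j))) (num_falls ?S 0 (i - 1))"
      using i tail[of i] by (simp add: falls_def)
  qed simp
  also have "\<dots> = (\<Sum>j<x. 1 / 2 * (t j * t (x - Suc j)))"
    by (subst sum_over_falls) (simp add: x)
  also have "\<dots> = 1 / 2"
    unfolding sum_distrib_left[symmetric] t_convolution_less using x0 by simp
  finally have 1: "(\<Sum>i\<in>falls ?S 1 n. 1 / 2 * t (num_falls R 0 (i - 1) - 1) * t (num_falls R (i - 1) n)) = 1 / 2" .
  \<comment> \<open>The forced fall at 1 is the term of rank 0; it is added to complete the sum and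
    then removed.\<close>
  have I: "falls R 0 n = insert 1 (falls R 1 n)" "1 \<notin> falls R 1 n"
    using R n by (auto simp: falls_def intro: Suc_lessI)
  let ?h = "\<lambda>i. 1 / 2 * t (num_falls R 0 (i - 1)) * t (num_falls R (i - 1) n)"
  have "(\<Sum>i\<in>falls R 1 n. ?h i) = (\<Sum>i\<in>falls R 0 n. ?h i) - ?h 1"
    using I by simp
  also have "(\<Sum>i\<in>falls R 0 n. ?h i) = (\<Sum>i\<in>falls R 0 n. (\<lambda>j. 1 / 2 * (t j * t (x - j))) (num_falls R 0 (i - 1)))"
    using tail by (intro sum.cong) (auto simp: falls_def)
  also have "\<dots> = (\<Sum>j<x. 1 / 2 * (t j * t (x - j)))"
    by (subst sum_over_falls) (simp add: x_def)
  also have "\<dots> = 1 / 2 * (1 - t x)"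
    unfolding sum_distrib_left[symmetric]
    using t_convolution[of x] by (simp add: lessThan_Suc_atMost[symmetric])
  finally show ?thesis
    unfolding 1 using tail[of 1] n by (simp add: algebra_simps x_def)
qed

text \<open>A cut at \<open>m\<close> belongs to the fall at \<open>m + 1\<close>. The recursions
  have \<open>m\<close> at least 1, so a fall at 1 is left out.\<close>

lemma sum_Suc_falls:
  assumes "1 \<le> n"
  shows "(\<Sum>m=1..n - 1. if R m \<and> \<not> R (m + 1) then h (m + 1) else 0) = (\<Sum>i\<in>falls R 1 n. h i)"
proof -
  have "falls R 1 n = Suc ` {m\<in>{1..n - 1}. R m \<and> \<not> R (m + 1)}"
  proof (intro equalityI subsetI)
    fix i assume "i \<in> falls R 1 n"
    then show "i \<in> Suc ` {m\<in>{1..n - 1}. R m \<and> \<not> R (m + 1)}"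
      by (intro image_eqI[of _ _ "i - 1"]) (auto simp: falls_def)
  qed (use assms in \<open>auto simp: falls_def\<close>)
  then have "(\<Sum>i\<in>falls R 1 n. h i) = (\<Sum>m\<in>{m\<in>{1..n - 1}. R m \<and> \<not> R (m + 1)}. h (m + 1))"
    by (simp add: sum.reindex)
  also have "\<dots> = (\<Sum>m=1..n - 1. if R m \<and> \<not> R (m + 1) then h (m + 1) else 0)"
    by (rule sum.inter_filter) simp
  finally show ?thesis ..
qed

subsection \<open>Pieces of a diagram\<close>

lemma psum_0 [simp]: "psum ks 0 = 0"
  by (simp add: psum_def)

lemma psum_Suc: "psum ks (Suc m) = psum ks m + entry ks (Suc m)"
  by (simp add: psum_def)

lemma psum_Suc_ge: "psum ks m \<le> psum ks (Suc m)"
  by (simp add: psum_Suc)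

lemma psum_length: "psum ks (length ks) = sum_list ks"
  unfolding psum_def entry_def
  by (simp add: sum_list_sum_nth atLeast0LessThan sum.atLeast1_atMost_eq)

lemma bloch_seq_psum: "bloch_seq ks \<longleftrightarrow> psum ks (length ks) = length ks"
  by (simp add: bloch_seq_def psum_length)

lemma psum_Cons: "psum (a # L) (Suc j) = a + psum L j"
  by (induction j) (auto simp: psum_Suc entry_def)

lemma psum_slice:
  "1 \<le> a \<Longrightarrow> j \<le> Suc b - a \<Longrightarrow> psum ks (a - 1) + psum (slice ks a b) j = psum ks (a - 1 + j)"
proof (induction j)
  case (Suc j)
  then have "entry (slice ks a b) (Suc j) = entry ks (a + j)"
    by (simp add: entry_def slice_def del: upt_Suc)
  moreover obtain a' where "a = Suc a'" using Suc.prems by (cases a) auto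
  ultimately show ?case using Suc by (simp add: psum_Suc)
qed simp

lemma psum_rev_slice:
  "j \<le> m - 1 \<Longrightarrow> psum ks (m - j) + psum (rev (slice ks 2 m)) j = psum ks m"
proof (induction j)
  case (Suc j)
  then have "Suc (Suc j) \<le> m" by simp
  then obtain d where m: "m = Suc (Suc j) + d"
    using le_Suc_ex by blast
  then have "entry (rev (slice ks 2 m)) (Suc j) = entry ks (m - j)"
    by (simp add: entry_def slice_def rev_nth del: upt_Suc)
  then show ?case using Suc m by (simp add: psum_Suc)
qed simp

text \<open>Its falls are the indices at which \<open>crossing_step\<close> increases
  \<open>n m\<close>.\<close>

definition weakly_above :: "nat list \<Rightarrow> nat \<Rightarrow> bool" where
  "weakly_above ks i \<longleftrightarrow> i \<le> psum ks i"

text \<open>Its rises are the indices at which \<open>crossing_step\<close> increases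
  \<open>N m\<close>; its falls give the cuts in the recursion for \<open>bloch_e\<close> and in the
  case \<open>1 < entry ks 1\<close>.\<close>

definition strictly_above :: "nat list \<Rightarrow> nat \<Rightarrow> bool" where
  "strictly_above ks i \<longleftrightarrow> i < psum ks i"

lemma weakly_above_0 [simp]: "weakly_above ks 0"
  by (simp add: weakly_above_def)

lemma not_strictly_above_0 [simp]: "\<not> strictly_above ks 0"
  by (simp add: strictly_above_def)

lemma bloch_above_length:
  "bloch_seq ks \<Longrightarrow> weakly_above ks (length ks)"
  "bloch_seq ks \<Longrightarrow> \<not> strictly_above ks (length ks)"
  by (simp_all add: weakly_above_def strictly_above_def bloch_seq_psum)

lemma strictly_above_imp:
  "strictly_above ks i \<Longrightarrow> weakly_above ks i"
  "strictly_above ks i \<Longrightarrow> weakly_above ks (Suc i)"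
  using psum_Suc_ge[of ks i] by (auto simp: strictly_above_def weakly_above_def)

text \<open>Rotation gives \<open>psum L j = m - psum ks (m + 1 - j)\<close>, so being weakly above
  at \<open>j\<close> is the negation of being so at \<open>m + 1 - j\<close>. The extra term is a
  possible fall of \<open>L\<close> at 1, which compares with the start on the diagonal.\<close>

lemma rotated_initial_segment:
  assumes "entry ks 1 = 0" "1 \<le> m" "psum ks m \<le> m"
  defines "L \<equiv> (m - psum ks m) # rev (slice ks 2 m)"
  shows "bloch_seq L" "length L = m"
    "num_falls (weakly_above L) 0 m = of_bool (weakly_above ks m) + num_falls (weakly_above ks) 1 m"
proof -
  show len: "length L = m" using assms(2) by (simp add: L_def)
  have K: "psum L j + psum ks (m + 1 - j) = m" if j: "1 \<le> j" "j \<le> m" for j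
  proof -
    obtain j' where j': "j = Suc j'" using j by (cases j) auto
    then have "psum ks (m - j') + psum (rev (slice ks 2 m)) j' = psum ks m"
      using psum_rev_slice[of j' m ks] j by simp
    then show ?thesis
      using assms(3) unfolding L_def j' psum_Cons by simp
  qed
  have "psum ks 1 = 0" using assms(1) psum_Suc[of ks 0] by simp
  then show "bloch_seq L" using K[of m] assms(2) by (simp add: bloch_seq_psum len)
  have P: "weakly_above L j = (\<not> weakly_above ks (m + 1 - j))" if "1 \<le> j" "j \<le> m" for j
    using K[OF that] that by (auto simp: weakly_above_def)
  have "num_falls (weakly_above L) 1 m = num_falls (weakly_above ks) 1 m"
    using num_falls_reflect[of 1 m "weakly_above L" "weakly_above ks" "m + 1"] P by simp
  then show "num_falls (weakly_above L) 0 m = of_bool (weakly_above ks m) + num_falls (weakly_above ks) 1 m"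
    using num_falls_from_1[OF assms(2), of "weakly_above L"] P[of 1] assms(2) by simp
qed

text \<open>The cut at the point (m, m) may lie inside an upward step, whose remainder becomes the
  first entry. Heights from there on are those of \<open>ks\<close> lowered by \<open>m\<close>.
  Since \<open>L\<close> starts on the diagonal while \<open>ks\<close> may be below it at
  \<open>m\<close>, the fall at 1 is counted separately.\<close>

lemma final_segment_with_rise:
  assumes "bloch_seq ks" "m < length ks" "m \<le> psum ks (m + 1)"
  defines "n \<equiv> length ks"
  defines "L \<equiv> (psum ks (m + 1) - m) # slice ks (m + 2) n"
  shows "bloch_seq L" "length L = n - m"
    "num_falls (weakly_above L) 0 (n - m) = of_bool (\<not> weakly_above ks (m + 1)) + num_falls (weakly_above ks) (m + 1) n"
proof -
  show len: "length L = n - m" using assms(2) by (simp add: L_def n_def)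
  have K: "psum L j + m = psum ks (j + m)" if j: "1 \<le> j" "j \<le> n - m" for j
  proof -
    obtain j' where j': "j = Suc j'" using j by (cases j) auto
    then have "psum ks (m + 1) + psum (slice ks (m + 2) n) j' = psum ks (j + m)"
      using psum_slice[of "m + 2" j' n ks] j by (simp add: add.commute)
    then show ?thesis
      using assms(3) unfolding L_def j' psum_Cons by linarith
  qed
  have "1 \<le> n - m" using assms(2) by (simp add: n_def)
  from K[OF this order_refl] show "bloch_seq L"
    using assms(1,2) by (simp add: bloch_seq_psum len n_def)
  have P: "weakly_above L j = weakly_above ks (j + m)" if "1 \<le> j" "j \<le> n - m" for j
    using K[OF that] that by (auto simp: weakly_above_def)
  have "num_falls (weakly_above L) 1 (n - m) = num_falls (weakly_above ks) (m + 1) n"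
    using num_falls_shift[of 1 "n - m" "weakly_above L" "weakly_above ks" m] P assms(2) by (simp add: n_def)
  then show "num_falls (weakly_above L) 0 (n - m) = of_bool (\<not> weakly_above ks (m + 1)) + num_falls (weakly_above ks) (m + 1) n"
    using num_falls_from_1[of "n - m" "weakly_above L"] P[of 1] assms(2) by (simp add: n_def)
qed

text \<open>Shortening the first step by one moves the upper diagonal onto the main one. The
  predicates differ at 0, but both hold at 1, so neither falls there.\<close>

lemma initial_segment_above_upper_diagonal:
  assumes "1 < entry ks 1" "1 \<le> p" "psum ks p = p + 1"
  defines "L \<equiv> (entry ks 1 - 1) # slice ks 2 p"
  shows "bloch_seq L" "length L = p"
    "num_falls (weakly_above L) 0 p = num_falls (strictly_above ks) 0 p"
proof -
  show len: "length L = p" using assms(2) by (simp add: L_def)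
  have K: "psum L j + 1 = psum ks j" if j: "1 \<le> j" "j \<le> p" for j
  proof -
    obtain j' where j': "j = Suc j'" using j by (cases j) auto
    then have "entry ks 1 + psum (slice ks 2 p) j' = psum ks j"
      using psum_slice[of 2 j' p ks] psum_Suc[of ks 0] j by simp
    then show ?thesis
      using assms(1) unfolding L_def j' psum_Cons by linarith
  qed
  show "bloch_seq L" using K[of p] assms(2,3) by (simp add: bloch_seq_psum len)
  have P: "weakly_above L j = strictly_above ks (j + 0)" if "1 \<le> j" "j \<le> p" for j
    using K[OF that] that by (auto simp: weakly_above_def strictly_above_def)
  have "strictly_above ks 1" using assms(1) psum_Suc[of ks 0] by (simp add: strictly_above_def)
  then show "num_falls (weakly_above L) 0 p = num_falls (strictly_above ks) 0 p"
    using num_falls_shift[of 1 p "weakly_above L" "strictly_above ks" 0, OF P] num_falls_from_1[OF assms(2)] P[of 1] assms(2) by simp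
qed

text \<open>A leading 0 shifts the path right by one, moving the upper diagonal onto the main one;
  the new first step contributes the additional fall.\<close>

lemma initial_segment_below_upper_diagonal:
  assumes "psum ks p = p + 1"
  defines "L \<equiv> 0 # slice ks 1 p"
  shows "bloch_seq L" "length L = p + 1"
    "num_falls (weakly_above L) 0 (p + 1) = Suc (num_falls (strictly_above ks) 0 p)"
proof -
  show len: "length L = p + 1" by (simp add: L_def)
  have K: "psum L (j + 1) = psum ks j" if "j \<le> p" for j
    using psum_slice[of 1 j p ks] that by (simp add: L_def psum_Cons)
  show "bloch_seq L" using K[of p] assms(1) by (simp add: bloch_seq_psum len)
  have P: "strictly_above ks j = weakly_above L (j + 1)" if "j \<le> p" for j
    using K[OF that] by (auto simp: weakly_above_def strictly_above_def)
  show "num_falls (weakly_above L) 0 (p + 1) = Suc (num_falls (strictly_above ks) 0 p)"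
    using num_falls_shift[of 0 p "strictly_above ks" "weakly_above L" 1] P num_falls_from_1[of "p + 1" "weakly_above L"] P[of 0] by simp
qed

lemma final_segment:
  assumes "bloch_seq ks" "i \<le> length ks" "psum ks i = i"
  defines "n \<equiv> length ks"
  defines "L \<equiv> slice ks (i + 1) n"
  shows "bloch_seq L" "length L = n - i"
    "crossing_weight (weakly_above L) (strictly_above L) 0 (n - i) =
     crossing_weight (weakly_above ks) (strictly_above ks) i n"
    "num_falls (weakly_above L) 0 (n - i) = num_falls (weakly_above ks) i n"
proof -
  show len: "length L = n - i" using assms(2) by (simp add: L_def n_def)
  have K: "psum L j + i = psum ks (j + i)" if "j \<le> n - i" for j
    using psum_slice[of "i + 1" j n ks] that assms(3) by (simp add: L_def ac_simps)
  show "bloch_seq L" using K[of "n - i"] assms(1,2) by (simp add: bloch_seq_psum len n_def)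
  have P: "weakly_above L j = weakly_above ks (j + i)" "strictly_above L j = strictly_above ks (j + i)" if "j \<le> n - i" for j
    using K[OF that] by (auto simp: weakly_above_def strictly_above_def)
  show "crossing_weight (weakly_above L) (strictly_above L) 0 (n - i) =
     crossing_weight (weakly_above ks) (strictly_above ks) i n"
    using crossing_weight_shift[of "n - i" "weakly_above L" "weakly_above ks" i "strictly_above L" "strictly_above ks"]
      P assms(2) by (simp add: n_def)
  show "num_falls (weakly_above L) 0 (n - i) = num_falls (weakly_above ks) i n"
    using num_falls_shift[of 0 "n - i" "weakly_above L" "weakly_above ks" i] P assms(2) by (simp add: n_def)
qed

text \<open>Relative to the diagonal a step descends by at most one, so a fall is a horizontal step
  from the upper to the main diagonal. This form matches the deltas in the recursion for
  \<open>bloch_c\<close>, the next one those for \<open>bloch_e\<close>.\<close>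

lemma strictly_above_fall_iff:
  "strictly_above ks p \<and> \<not> strictly_above ks (p + 1) \<longleftrightarrow> entry ks (p + 1) = 0 \<and> psum ks p = p + 1"
  using psum_Suc[of ks p] by (auto simp: strictly_above_def)

lemma strictly_above_fall_iff':
  "strictly_above ks p \<and> \<not> strictly_above ks (p + 1) \<longleftrightarrow> entry ks (p + 1) = 0 \<and> psum ks (p + 1) = p + 1"
  using psum_Suc[of ks p] by (auto simp: strictly_above_def)

text \<open>The recursions count the cut from the right, hence the reversal
  \<open>p = n - m\<close>. The path starts on the diagonal, so no fall at 1 is lost.\<close>

lemma sum_over_strict_falls:
  assumes "1 \<le> n"
  assumes summand: "\<And>p. 1 \<le> p \<Longrightarrow> p < n \<Longrightarrow> g (n - p) = (if strictly_above ks p \<and> \<not> strictly_above ks (p + 1) then h (p + 1) else 0)"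
  shows "(\<Sum>m=1..n - 1. g m) = (\<Sum>i\<in>falls (strictly_above ks) 0 n. h i)"
proof -
  have "(\<Sum>m=1..n - 1. g m) = (\<Sum>p=1..n - 1. g (n - p))"
    using assms(1) by (subst sum.atLeastAtMost_rev) (auto intro!: sum.cong)
  also have "\<dots> = (\<Sum>p=1..n - 1. if strictly_above ks p \<and> \<not> strictly_above ks (p + 1) then h (p + 1) else 0)"
    by (rule sum.cong) (use summand in auto)
  also have "\<dots> = (\<Sum>i\<in>falls (strictly_above ks) 1 n. h i)"
    by (rule sum_Suc_falls) (rule assms(1))
  also have "falls (strictly_above ks) 1 n = falls (strictly_above ks) 0 n"
    by (auto simp: falls_def) (metis One_nat_def Suc_lessI diff_Suc_1 not_strictly_above_0)
  finally show ?thesis .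
qed

subsection \<open>The recursion\<close>

lemma bloch_c_step:
  assumes c: "\<And>L. bloch_seq L \<Longrightarrow> 1 \<le> length L \<Longrightarrow> length L < length ks \<Longrightarrow>
      bloch_c L = t (num_falls (weakly_above L) 0 (length L))"
    and e: "\<And>L. bloch_seq L \<Longrightarrow> length L < length ks \<Longrightarrow>
      bloch_e L = crossing_weight (weakly_above L) (strictly_above L) 0 (length L)"
    and ks: "bloch_seq ks" "1 \<le> length ks"
  shows "bloch_c ks = t (num_falls (weakly_above ks) 0 (length ks))"
proof -
  define n where "n = length ks"
  let ?P = "weakly_above ks" and ?Q = "strictly_above ks"
  have Kn: "psum ks n = n" using ks(1) by (simp add: bloch_seq_psum n_def)
  have K1: "psum ks 1 = entry ks 1" using psum_Suc[of ks 0] by simp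
  have n1: "1 \<le> n" using ks by (simp add: n_def)
  consider "n = 1" | "1 < n" "entry ks 1 = 0" | "1 < n" "entry ks 1 = 1" | "1 < n" "1 < entry ks 1"
    using n1 by linarith
  then show ?thesis
  proof cases
    case 1
    then obtain a where "ks = [a]" unfolding n_def by (metis length_0_conv length_Suc_conv One_nat_def)
    then have "ks = [1]" using ks(1) by (simp add: bloch_seq_def)
    then show ?thesis by (simp add: bloch_c.simps num_falls_one weakly_above_def psum_def entry_def)
  next
    case 2
    let ?T = "\<lambda>m. 1 / 2 * (1 - kdelta m (psum ks m) - kdelta m (psum ks (m + 1))) *
          bloch_c ((m - psum ks m) # rev (slice ks 2 m)) *
          bloch_c ((psum ks (m + 1) - m) # slice ks (m + 2) n)"
    \<comment> \<open>\<open>?U\<close> collects the rises and \<open>?D\<close> the falls; the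
      double negation and \<open>m + 1 - 1\<close> fit the pattern of
      \<open>sum_Suc_falls\<close>.\<close>
    let ?U = "\<lambda>m. if \<not> ?P m \<and> \<not> \<not> ?P (m + 1) then 1 / 2 * t (num_falls ?P 0 (m + 1 - 1) - 1) * t (num_falls ?P (m + 1 - 1) n) else 0"
    let ?D = "\<lambda>m. if ?P m \<and> \<not> ?P (m + 1) then 1 / 2 * t (num_falls ?P 0 (m + 1 - 1)) * t (num_falls ?P (m + 1 - 1) n) else 0"
    have "bloch_c ks = (\<Sum>m\<in>{m\<in>{1..n - 1}. psum ks m \<le> m \<and> m - psum ks m \<le> entry ks (m + 1)}. ?T m)"
      using 2 by (subst bloch_c.simps) (simp add: Let_def n_def)
    also have "\<dots> = (\<Sum>m=1..n - 1. if psum ks m \<le> m \<and> m - psum ks m \<le> entry ks (m + 1) then ?T m else 0)"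
      by (rule sum.inter_filter) simp
    also have "\<dots> = (\<Sum>m=1..n - 1. ?U m - ?D m)"
    proof (rule sum.cong)
      fix m assume "m \<in> {1..n - 1}"
      then have m: "1 \<le> m" "m < n" by auto
      show "(if psum ks m \<le> m \<and> m - psum ks m \<le> entry ks (m + 1) then ?T m else 0) = ?U m - ?D m"
      proof (cases "psum ks m \<le> m \<and> m - psum ks m \<le> entry ks (m + 1)")
        \<comment> \<open>For an excluded \<open>m\<close>, \<open>weakly_above ks\<close> has the
          same value at \<open>m\<close> and \<open>m + 1\<close>, so both sides vanish.\<close>
        case False
        then show ?thesis using psum_Suc[of ks m] by (auto simp: weakly_above_def)
      next
        case True
        then have K: "psum ks m \<le> m" "m \<le> psum ks (m + 1)" using psum_Suc[of ks m] by auto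
        note rot = rotated_initial_segment[OF 2(2) m(1) K(1)]
        note fin = final_segment_with_rise[OF ks(1) m(2)[unfolded n_def] K(2), folded n_def]
        have 0: "num_falls ?P 0 m = 1 + num_falls ?P 1 m"
          using num_falls_from_1[OF m(1), of ?P] 2(2) K1 by (simp add: weakly_above_def)
        have 1: "num_falls ?P m n = of_bool (?P m \<and> \<not> ?P (m + 1)) + num_falls ?P (m + 1) n"
          using num_falls_split[of m "m + 1" n ?P] num_falls_Suc[of m m ?P] m by simp
        have c1: "bloch_c ((m - psum ks m) # rev (slice ks 2 m)) = t (of_bool (?P m) + num_falls ?P 1 m)"
          using c[OF rot(1)] m by (simp only: rot n_def)
        have c2: "bloch_c ((psum ks (m + 1) - m) # slice ks (m + 2) n) = t (of_bool (\<not> ?P (m + 1)) + num_falls ?P (m + 1) n)"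
          using c[OF fin(1)] m by (simp only: fin n_def[symmetric])
        \<comment> \<open>The prefactor is 1/2 at a rise and -1/2 at a fall. It is 0 when exactly
          one delta is 1, and then there is neither.\<close>
        show ?thesis
          using K True unfolding c1 c2 add_diff_cancel_right' 0 1
          by (auto simp: weakly_above_def kdelta_def)
      qed
    qed simp
    also have "\<dots> = (\<Sum>m=1..n - 1. ?U m) - (\<Sum>m=1..n - 1. ?D m)"
      by (rule sum_subtractf)
    also have "\<dots> = t (num_falls ?P 0 n)"
      unfolding sum_Suc_falls[OF n1, of "\<lambda>i. \<not> ?P i" "\<lambda>i. 1 / 2 * t (num_falls ?P 0 (i - 1) - 1) * t (num_falls ?P (i - 1) n)"]
        sum_Suc_falls[OF n1, of ?P "\<lambda>i. 1 / 2 * t (num_falls ?P 0 (i - 1)) * t (num_falls ?P (i - 1) n)"]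
      by (rule crossing_sum_eq_t) (use 2 n1 K1 Kn in \<open>auto simp: weakly_above_def\<close>)
    finally show ?thesis by (simp add: n_def)
  next
    case 3
    have "bloch_c ks = bloch_c (slice ks 2 n)"
      using 3 by (subst bloch_c.simps) (simp add: Let_def n_def)
    moreover note fin = final_segment[OF ks(1), of 1, folded n_def]
    have "num_falls ?P 0 n = num_falls ?P 1 n"
      using num_falls_from_1[OF n1, of ?P] 3 K1 by (simp add: weakly_above_def)
    ultimately show ?thesis
      using c[of "slice ks 2 n"] fin 3 K1 by (simp add: n_def numeral_2_eq_2)
  next
    case 4
    let ?g = "\<lambda>m. kdelta 0 (entry ks (n - m + 1)) * kdelta (n - m + 1) (psum ks (n - m)) *
          bloch_c ((entry ks 1 - 1) # slice ks 2 (n - m)) *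
          bloch_e (slice ks (n - m + 2) n)"
    have "bloch_c ks = (\<Sum>m=1..n - 1. ?g m)"
      using 4 by (subst bloch_c.simps) (simp add: Let_def n_def)
    also have "\<dots> = (\<Sum>i\<in>falls ?Q 0 n. t (num_falls ?Q 0 (i - 1)) * crossing_weight ?P ?Q i n)"
    proof (rule sum_over_strict_falls[OF n1])
      fix p assume p: "1 \<le> p" "p < n"
      show "?g (n - p) = (if ?Q p \<and> \<not> ?Q (p + 1) then t (num_falls ?Q 0 (p + 1 - 1)) * crossing_weight ?P ?Q (p + 1) n else 0)"
      proof (cases "?Q p \<and> \<not> ?Q (p + 1)")
        case True
        then have k: "entry ks (p + 1) = 0" "psum ks p = p + 1" by (simp_all only: strictly_above_fall_iff)
        then have k': "psum ks (p + 1) = p + 1" by (simp add: psum_Suc)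
        note ini = initial_segment_above_upper_diagonal[OF 4(2) p(1) k(2)]
        note fin = final_segment[OF ks(1) _ k', folded n_def]
        have "bloch_c ((entry ks 1 - 1) # slice ks 2 p) = t (num_falls ?Q 0 p)"
          using c[OF ini(1)] p by (simp only: ini n_def)
        moreover have "bloch_e (slice ks (p + 2) n) = crossing_weight ?P ?Q (p + 1) n"
          using e[OF fin(1)] fin p by (simp add: n_def)
        moreover have "n - (n - p) = p" using p by simp
        ultimately show ?thesis using True k by (simp add: kdelta_def)
      next
        case False
        moreover have "n - (n - p) = p" using p by simp
        ultimately show ?thesis
          unfolding strictly_above_fall_iff by (auto simp: kdelta_def)
      qed
    qed
    also have "\<dots> = t (num_falls ?P 0 n)"
      by (rule sum_falls_crossing_weight_eq_t)
        (use 4 n1 K1 Kn strictly_above_imp in \<open>auto simp: strictly_above_def\<close>)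
    finally show ?thesis by (simp add: n_def)
  qed
qed

text \<open>The recursion for \<open>bloch_e\<close> uses \<open>bloch_c\<close> on
  \<open>ks\<close> itself and on pieces \<open>0 # slice ks 1 p\<close> as long as
  \<open>ks\<close>, so the hypothesis on \<open>bloch_c\<close> includes this length.\<close>

lemma bloch_e_step:
  assumes c: "\<And>L. bloch_seq L \<Longrightarrow> 1 \<le> length L \<Longrightarrow> length L \<le> length ks \<Longrightarrow>
      bloch_c L = t (num_falls (weakly_above L) 0 (length L))"
    and e: "\<And>L. bloch_seq L \<Longrightarrow> length L < length ks \<Longrightarrow>
      bloch_e L = crossing_weight (weakly_above L) (strictly_above L) 0 (length L)"
    and ks: "bloch_seq ks"
  shows "bloch_e ks = crossing_weight (weakly_above ks) (strictly_above ks) 0 (length ks)"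
proof (cases "ks = []")
  case True
  then show ?thesis by (simp add: bloch_e.simps crossing_weight_def falls_def)
next
  case False
  define n where "n = length ks"
  let ?P = "weakly_above ks" and ?Q = "strictly_above ks"
  have n1: "1 \<le> n" using False by (simp add: n_def Suc_leI)
  let ?g = "\<lambda>m. kdelta 0 (entry ks (n + 1 - m)) * kdelta (n + 1 - m) (psum ks (n + 1 - m)) *
          bloch_c (0 # slice ks 1 (n - m)) *
          bloch_e (slice ks (n - m + 2) n)"
  have "bloch_e ks = bloch_c ks - (\<Sum>m=1..n - 1. ?g m)"
    using False by (subst bloch_e.simps) (simp add: Let_def n_def)
  also have "(\<Sum>m=1..n - 1. ?g m) = (\<Sum>i\<in>falls ?Q 0 n. t (Suc (num_falls ?Q 0 (i - 1))) * crossing_weight ?P ?Q i n)"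
  proof (rule sum_over_strict_falls[OF n1])
    fix p assume p: "1 \<le> p" "p < n"
    then have np: "n - (n - p) = p" "n + 1 - (n - p) = p + 1" by simp_all
    show "?g (n - p) = (if ?Q p \<and> \<not> ?Q (p + 1) then t (Suc (num_falls ?Q 0 (p + 1 - 1))) * crossing_weight ?P ?Q (p + 1) n else 0)"
    proof (cases "?Q p \<and> \<not> ?Q (p + 1)")
      case True
      then have k: "entry ks (p + 1) = 0" "psum ks (p + 1) = p + 1" "psum ks p = p + 1"
        using strictly_above_fall_iff strictly_above_fall_iff' by blast+
      note ini = initial_segment_below_upper_diagonal[OF k(3)]
      note fin = final_segment[OF ks _ k(2), folded n_def]
      have "bloch_c (0 # slice ks 1 p) = t (Suc (num_falls ?Q 0 p))"
        using c[OF ini(1)] p by (simp add: ini[simplified] n_def)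
      moreover have "bloch_e (slice ks (p + 2) n) = crossing_weight ?P ?Q (p + 1) n"
        using e[OF fin(1)] fin p by (simp add: n_def)
      ultimately show ?thesis using True k unfolding np by (simp add: kdelta_def)
    next
      case False
      then show ?thesis
        unfolding strictly_above_fall_iff' np by (auto simp: kdelta_def)
    qed
  qed
  also have "bloch_c ks = t (num_falls ?P 0 n)"
    using c[OF ks] n1 by (simp add: n_def)
  finally show ?thesis
    unfolding n_def by (simp only: crossing_weight_recursion)
qed

text \<open>Joint induction on the length; at each length \<open>bloch_c\<close> is settled first,
  from strictly shorter sequences, and then \<open>bloch_e\<close>.\<close>

lemma bloch_c_e_eq:
  "(bloch_seq ks \<longrightarrow> 1 \<le> length ks \<longrightarrow> bloch_c ks = t (num_falls (weakly_above ks) 0 (length ks))) \<and>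
   (bloch_seq ks \<longrightarrow> bloch_e ks = crossing_weight (weakly_above ks) (strictly_above ks) 0 (length ks))"
proof (induction "length ks" arbitrary: ks rule: less_induct)
  case less
  have c: "bloch_c L = t (num_falls (weakly_above L) 0 (length L))"
    if "bloch_seq L" "1 \<le> length L" "length L \<le> length ks" for L
    by (rule bloch_c_step) (use less that in auto)
  show ?case
    using c bloch_e_step[of ks] less by auto
qed

subsection \<open>Crossing numbers\<close>

text \<open>The procedure counts a passage above the upper diagonal when it begins, \<open>falls\<close> when it ends;
  the last summand accounts for a passage still in progress at \<open>j\<close>. The weight \<open>f\<close> replaces \<open>t\<close>
  so that a new crossing below the main diagonal can be absorbed as \<open>f \<circ> Suc\<close> in an induction on \<open>j\<close>.\<close>

definition fall_sum :: "(nat \<Rightarrow> bool) \<Rightarrow> (nat \<Rightarrow> bool) \<Rightarrow> (nat \<Rightarrow> rat) \<Rightarrow> nat \<Rightarrow> rat" where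
  "fall_sum P Q f j =
    (\<Sum>i\<in>falls Q 0 j. (t (num_falls Q 0 i) - t (num_falls Q 0 (i - 1))) * f (num_falls P i j)) +
    (if Q j then (t (Suc (num_falls Q 0 j)) - t (num_falls Q 0 j)) * f 0 else 0)"

lemma falls_le: "i \<in> falls R a b \<Longrightarrow> i \<le> b"
  by (simp add: falls_def)

lemma fall_sum_rise:
  assumes "\<not> Q j" "Q (Suc j)" "P (Suc j)"
  shows "fall_sum P Q f (Suc j) = fall_sum P Q f j + (t (Suc (num_falls Q 0 j)) - t (num_falls Q 0 j)) * f 0"
proof -
  have "(\<Sum>i\<in>falls Q 0 j. (t (num_falls Q 0 i) - t (num_falls Q 0 (i - 1))) * f (num_falls P i (Suc j)))
      = (\<Sum>i\<in>falls Q 0 j. (t (num_falls Q 0 i) - t (num_falls Q 0 (i - 1))) * f (num_falls P i j))"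
    using assms by (intro sum.cong) (auto simp: num_falls_Suc dest: falls_le)
  then show ?thesis
    using assms by (simp add: fall_sum_def falls_Suc num_falls_Suc)
qed

lemma fall_sum_lower_fall:
  assumes "P j" "\<not> P (Suc j)" "\<not> Q j" "\<not> Q (Suc j)"
  shows "fall_sum P Q f (Suc j) = fall_sum P Q (f \<circ> Suc) j"
proof -
  have "(\<Sum>i\<in>falls Q 0 j. (t (num_falls Q 0 i) - t (num_falls Q 0 (i - 1))) * f (num_falls P i (Suc j)))
      = (\<Sum>i\<in>falls Q 0 j. (t (num_falls Q 0 i) - t (num_falls Q 0 (i - 1))) * f (Suc (num_falls P i j)))"
    using assms by (intro sum.cong) (auto simp: num_falls_Suc dest: falls_le)
  then show ?thesis
    using assms by (simp add: fall_sum_def falls_Suc)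
qed

text \<open>When a passage above the upper diagonal ends, its pending summand becomes the ordinary
  summand of the new fall, with the same value.\<close>

lemma fall_sum_no_entry:
  assumes "\<not> (P j \<and> \<not> P (Suc j))" "\<not> (\<not> Q j \<and> Q (Suc j))"
  shows "fall_sum P Q f (Suc j) = fall_sum P Q f j"
proof -
  have "(\<Sum>i\<in>falls Q 0 j. (t (num_falls Q 0 i) - t (num_falls Q 0 (i - 1))) * f (num_falls P i (Suc j)))
      = (\<Sum>i\<in>falls Q 0 j. (t (num_falls Q 0 i) - t (num_falls Q 0 (i - 1))) * f (num_falls P i j))"
    using assms by (intro sum.cong) (auto simp: num_falls_Suc dest: falls_le)
  then show ?thesis
    using assms by (auto simp: fall_sum_def falls_Suc num_falls_Suc)
qed

text \<open>The claimed formula for \<open>bloch_e\<close> without its \<open>kdelta i 1\<close>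
  term, with \<open>t\<close> replaced by \<open>f\<close> in the last factor.\<close>

definition block_sum :: "nat \<Rightarrow> (nat \<Rightarrow> nat) \<Rightarrow> (nat \<Rightarrow> nat) \<Rightarrow> (nat \<Rightarrow> rat) \<Rightarrow> rat" where
  "block_sum m N n f =
    (\<Sum>i=1..m. (t (\<Sum>l=1..i. N l) - t (\<Sum>l=1..i - 1. N l)) * f (\<Sum>l=i..m. n l))"

text \<open>Only the difference belonging to the last block changes, and its factor is
  \<open>f 0\<close> because the block has no lower crossings yet.\<close>

lemma block_sum_upper:
  assumes "n (Suc m) = 0"
  shows "block_sum (Suc m) (N(Suc m := Suc (N (Suc m)))) n f =
    block_sum (Suc m) N n f + (t (Suc (\<Sum>l=1..Suc m. N l)) - t (\<Sum>l=1..Suc m. N l)) * f 0"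
proof -
  let ?N = "N(Suc m := Suc (N (Suc m)))"
  have N: "(\<Sum>l=1..i. ?N l) = (\<Sum>l=1..i. N l)" if "i \<le> m" for i
    using that by (intro sum.cong) auto
  have "(\<Sum>i=1..m. (t (\<Sum>l=1..i. ?N l) - t (\<Sum>l=1..i - 1. ?N l)) * f (\<Sum>l=i..Suc m. n l))
      = (\<Sum>i=1..m. (t (\<Sum>l=1..i. N l) - t (\<Sum>l=1..i - 1. N l)) * f (\<Sum>l=i..Suc m. n l))"
  proof (rule sum.cong)
    fix i assume "i \<in> {1..m}"
    then have "i \<le> m" "i - 1 \<le> m" by auto
    then show "(t (\<Sum>l=1..i. ?N l) - t (\<Sum>l=1..i - 1. ?N l)) * f (\<Sum>l=i..Suc m. n l)
        = (t (\<Sum>l=1..i. N l) - t (\<Sum>l=1..i - 1. N l)) * f (\<Sum>l=i..Suc m. n l)"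
      by (simp only: N)
  qed simp
  moreover have "(\<Sum>l=1..Suc m. ?N l) = Suc (\<Sum>l=1..Suc m. N l)"
    using N[of m] by simp
  ultimately show ?thesis
    using assms N[of m] unfolding block_sum_def by (simp add: algebra_simps)
qed

lemma block_sum_new_block:
  "block_sum (Suc m) (N(Suc m := 1)) (n(Suc m := 0)) f =
    block_sum m N n f + (t (Suc (\<Sum>l=1..m. N l)) - t (\<Sum>l=1..m. N l)) * f 0"
proof -
  let ?N = "N(Suc m := 1)"
  have N: "(\<Sum>l=1..i. ?N l) = (\<Sum>l=1..i. N l)" if "i \<le> m" for i
    using that by (intro sum.cong) auto
  have n: "(\<Sum>l=i..Suc m. (n(Suc m := 0)) l) = (\<Sum>l=i..m. n l)" if "i \<le> m" for i
  proof -
    have "(\<Sum>l=i..m. (n(Suc m := 0)) l) = (\<Sum>l=i..m. n l)"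
      by (rule sum.cong) auto
    then show ?thesis using that by simp
  qed
  have "(\<Sum>i=1..m. (t (\<Sum>l=1..i. ?N l) - t (\<Sum>l=1..i - 1. ?N l)) * f (\<Sum>l=i..Suc m. (n(Suc m := 0)) l))
      = block_sum m N n f"
    unfolding block_sum_def
  proof (rule sum.cong)
    fix i assume "i \<in> {1..m}"
    then have "i \<le> m" "i - 1 \<le> m" by auto
    then show "(t (\<Sum>l=1..i. ?N l) - t (\<Sum>l=1..i - 1. ?N l)) * f (\<Sum>l=i..Suc m. (n(Suc m := 0)) l)
        = (t (\<Sum>l=1..i. N l) - t (\<Sum>l=1..i - 1. N l)) * f (\<Sum>l=i..m. n l)"
      by (simp only: N n)
  qed simp
  then show ?thesis
    unfolding block_sum_def[of "Suc m"] using N[of m] by simp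
qed

text \<open>The last block belongs to every tail sum, so each argument of \<open>f\<close> grows by
  one.\<close>

lemma block_sum_lower:
  "block_sum m N (n(m := Suc (n m))) f = block_sum m N n (f \<circ> Suc)"
  unfolding block_sum_def
proof (rule sum.cong)
  fix i assume i: "i \<in> {1..m}"
  then obtain k where k: "m = Suc k" by (cases m) auto
  have "(\<Sum>l=i..k. (n(m := Suc (n m))) l) = (\<Sum>l=i..k. n l)"
    using k by (intro sum.cong) auto
  then have "(\<Sum>l=i..m. (n(m := Suc (n m))) l) = Suc (\<Sum>l=i..m. n l)"
    using i k by simp
  then show "(t (\<Sum>l=1..i. N l) - t (\<Sum>l=1..i - 1. N l)) * f (\<Sum>l=i..m. (n(m := Suc (n m))) l)
      = (t (\<Sum>l=1..i. N l) - t (\<Sum>l=1..i - 1. N l)) * (f \<circ> Suc) (\<Sum>l=i..m. n l)"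
    by simp
qed simp

text \<open>The flag \<open>x = 1\<close> guarantees a current block without lower crossings, as
  \<open>block_sum_upper\<close> needs. The \<open>of_bool\<close> term counts a passage that has
  begun but not ended.\<close>

definition crossing_invariant :: "nat list \<Rightarrow> nat \<Rightarrow> crossing_state \<Rightarrow> bool" where
  "crossing_invariant ks j s \<longleftrightarrow> (case s of (m, N, n, x) \<Rightarrow>
     1 \<le> m \<and> (x = 1 \<longrightarrow> n m = 0) \<and>
     (\<Sum>l=1..m. N l) = num_falls (strictly_above ks) 0 j + of_bool (strictly_above ks j) \<and>
     (\<Sum>l=1..m. n l) = num_falls (weakly_above ks) 0 j \<and>
     (\<forall>f. block_sum m N n f = fall_sum (weakly_above ks) (strictly_above ks) f j))"

lemma crossing_invariant_step:
  assumes "crossing_invariant ks j s"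
  shows "crossing_invariant ks (Suc j) (crossing_step ks (Suc j) s)"
proof -
  obtain m N n x where s: "s = (m, N, n, x)" by (cases s) auto
  let ?P = "weakly_above ks" and ?Q = "strictly_above ks"
  have inv: "1 \<le> m" "x = 1 \<Longrightarrow> n m = 0"
    "(\<Sum>l=1..m. N l) = num_falls ?Q 0 j + of_bool (?Q j)"
    "(\<Sum>l=1..m. n l) = num_falls ?P 0 j"
    "\<And>f. block_sum m N n f = fall_sum ?P ?Q f j"
    using assms by (auto simp: s crossing_invariant_def)
  obtain k where m: "m = Suc k" using inv(1) by (cases m) auto
  have iff: "psum ks (Suc j) > Suc j \<and> psum ks (Suc j - 1) \<le> Suc j - 1 \<longleftrightarrow> ?Q (Suc j) \<and> \<not> ?Q j"
    "psum ks (Suc j) < Suc j \<and> psum ks (Suc j - 1) \<ge> Suc j - 1 \<longleftrightarrow> \<not> ?P (Suc j) \<and> ?P j"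
    by (auto simp: weakly_above_def strictly_above_def)
  consider (upper) "?Q (Suc j)" "\<not> ?Q j" | (lower) "\<not> (?Q (Suc j) \<and> \<not> ?Q j)" "\<not> ?P (Suc j)" "?P j"
    | (none) "\<not> (?Q (Suc j) \<and> \<not> ?Q j)" "\<not> (\<not> ?P (Suc j) \<and> ?P j)" by blast
  then show ?thesis
  proof cases
    case upper
    then have P: "?P (Suc j)" by (simp add: strictly_above_imp)
    note rise = fall_sum_rise[of ?Q j ?P, OF upper(2,1) P]
    show ?thesis
    proof (cases "x = 1")
      case True
      have step: "crossing_step ks (Suc j) s = (m, N(m := Suc (N m)), n, x)"
        using upper True unfolding s crossing_step.simps iff by simp
      have "(\<Sum>l=1..k. (N(m := Suc (N m))) l) = (\<Sum>l=1..k. N l)"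
        unfolding m by (intro sum.cong) auto
      then have "(\<Sum>l=1..m. (N(m := Suc (N m))) l) = Suc (\<Sum>l=1..m. N l)"
        by (simp add: m)
      moreover have "block_sum m (N(m := Suc (N m))) n f = fall_sum ?P ?Q f (Suc j)" for f
        using block_sum_upper[of n k N f] inv(2)[OF True] inv(3) inv(5)[of f] rise[of f] upper unfolding m by simp
      ultimately show ?thesis
        using inv P upper unfolding step crossing_invariant_def by (simp add: num_falls_Suc)
    next
      case False
      have step: "crossing_step ks (Suc j) s = (Suc m, N(Suc m := 1), n(Suc m := 0), 1)"
        using upper False unfolding s crossing_step.simps iff by simp
      have "(\<Sum>l=1..m. (N(Suc m := 1)) l) = (\<Sum>l=1..m. N l)" "(\<Sum>l=1..m. (n(Suc m := 0)) l) = (\<Sum>l=1..m. n l)"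
        by (intro sum.cong; auto)+
      then have "(\<Sum>l=1..Suc m. (N(Suc m := 1)) l) = Suc (\<Sum>l=1..m. N l)" "(\<Sum>l=1..Suc m. (n(Suc m := 0)) l) = (\<Sum>l=1..m. n l)"
        by simp_all
      moreover have "block_sum (Suc m) (N(Suc m := 1)) (n(Suc m := 0)) f = fall_sum ?P ?Q f (Suc j)" for f
        using block_sum_new_block[of m N n f] inv(3) inv(5)[of f] rise[of f] upper by simp
      ultimately show ?thesis
        using inv P upper unfolding step crossing_invariant_def by (simp add: num_falls_Suc)
    qed
  next
    case lower
    \<comment> \<open>A drop below the main diagonal is a horizontal step starting on it, so no
      passage above the upper diagonal is pending.\<close>
    have K: "psum ks (Suc j) = j" "psum ks j = j"
      using lower psum_Suc_ge[of ks j] by (auto simp: weakly_above_def)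
    then have Q: "\<not> ?Q j" "\<not> ?Q (Suc j)" by (simp_all add: strictly_above_def)
    have step: "crossing_step ks (Suc j) s = (m, N, n(m := Suc (n m)), 0)"
      using lower unfolding s crossing_step.simps iff by simp
    have "(\<Sum>l=1..k. (n(m := Suc (n m))) l) = (\<Sum>l=1..k. n l)"
      unfolding m by (intro sum.cong) auto
    then have "(\<Sum>l=1..m. (n(m := Suc (n m))) l) = Suc (\<Sum>l=1..m. n l)"
      by (simp add: m)
    moreover have "block_sum m N (n(m := Suc (n m))) f = fall_sum ?P ?Q f (Suc j)" for f
      using fall_sum_lower_fall[of ?P j ?Q f] lower Q inv(5) by (simp add: block_sum_lower)
    ultimately show ?thesis
      using inv lower Q unfolding step crossing_invariant_def by (simp add: num_falls_Suc)
  next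
    case none
    have step: "crossing_step ks (Suc j) s = (m, N, n, x)"
      using none unfolding s crossing_step.simps iff by auto
    have "block_sum m N n f = fall_sum ?P ?Q f (Suc j)" for f
      by (subst fall_sum_no_entry) (use none inv(5) in auto)
    moreover have "num_falls ?Q 0 (Suc j) + of_bool (?Q (Suc j)) = num_falls ?Q 0 j + of_bool (?Q j)"
      "num_falls ?P 0 (Suc j) = num_falls ?P 0 j"
      using none by (auto simp: num_falls_Suc)
    ultimately show ?thesis
      using inv unfolding step crossing_invariant_def by simp
  qed
qed

lemma crossing_invariant_result: "crossing_invariant ks (length ks) (crossing_result ks)"
proof -
  have "crossing_invariant ks j (fold (crossing_step ks) [1..<Suc j] (1, (\<lambda>_. 0), (\<lambda>_. 0), 1))" for j
  proof (induction j)
    case 0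
    show ?case
      by (simp add: crossing_invariant_def block_sum_def fall_sum_def falls_def)
  next
    case (Suc j)
    have "[1..<Suc (Suc j)] = [1..<Suc j] @ [Suc j]" by simp
    then show ?case using crossing_invariant_step[OF Suc.IH] by simp
  qed
  then show ?thesis by (simp add: crossing_result_def)
qed

text \<open>The path ends on the diagonal, so the pending summand of \<open>fall_sum\<close>
  vanishes at the end and the invariant gives the sum in \<open>crossing_weight\<close>.\<close>

lemma crossing_numbers_sums:
  assumes "bloch_seq ks"
  shows "(\<Sum>i=1..num_blocks ks. lower_crossings ks i) = num_falls (weakly_above ks) 0 (length ks)"
    and "crossing_weight (weakly_above ks) (strictly_above ks) 0 (length ks) =
      (\<Sum>i=1..num_blocks ks.
                 (t (\<Sum>l=1..i. upper_crossings ks l) - t (\<Sum>l=1..i - 1. upper_crossings ks l)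
                    + kdelta i 1) *
                 t (\<Sum>j=i..num_blocks ks. lower_crossings ks j))"
proof -
  obtain m N n x where r: "crossing_result ks = (m, N, n, x)" by (cases "crossing_result ks") auto
  have eqs: "num_blocks ks = m" "upper_crossings ks = N" "lower_crossings ks = n"
    by (simp_all add: num_blocks_def upper_crossings_def lower_crossings_def r)
  have inv: "1 \<le> m" "(\<Sum>l=1..m. n l) = num_falls (weakly_above ks) 0 (length ks)"
    "block_sum m N n t = fall_sum (weakly_above ks) (strictly_above ks) t (length ks)"
    using crossing_invariant_result[of ks] by (auto simp: r crossing_invariant_def)
  show "(\<Sum>i=1..num_blocks ks. lower_crossings ks i) = num_falls (weakly_above ks) 0 (length ks)"
    using inv by (simp add: eqs)
  \<comment> \<open>The delta term supplies the leading summand of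
    \<open>crossing_weight\<close>.\<close>
  have "(\<Sum>i=1..m. kdelta i 1 * t (\<Sum>l=i..m. n l)) = (\<Sum>i=1..m. if i = 1 then t (\<Sum>l=i..m. n l) else 0)"
    by (rule sum.cong) (auto simp: kdelta_def)
  also have "\<dots> = t (\<Sum>l=1..m. n l)" using inv(1) by simp
  finally show "crossing_weight (weakly_above ks) (strictly_above ks) 0 (length ks) =
      (\<Sum>i=1..num_blocks ks.
                 (t (\<Sum>l=1..i. upper_crossings ks l) - t (\<Sum>l=1..i - 1. upper_crossings ks l)
                    + kdelta i 1) *
                 t (\<Sum>j=i..num_blocks ks. lower_crossings ks j))"
    using inv(2,3) bloch_above_length(2)[OF assms] unfolding eqs
    by (simp add: crossing_weight_def fall_sum_def block_sum_def distrib_right sum.distrib)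
qed

subsection \<open>Passages through the main diagonal\<close>

text \<open>The count in \<open>diagonal_crossings\<close> for an arbitrary list, so that it can be
  followed along prefixes of the path.\<close>

definition sign_changes :: "int list \<Rightarrow> nat" where
  "sign_changes L = card {j. Suc j < length L \<and> sgn (L ! j) \<noteq> sgn (L ! Suc j)}"

lemma sign_changes_singleton [simp]: "sign_changes [a] = 0"
  by (simp add: sign_changes_def)

lemma sign_changes_snoc:
  assumes "L \<noteq> []"
  shows "sign_changes (L @ [a]) = sign_changes L + of_bool (sgn (last L) \<noteq> sgn a)"
proof -
  obtain k where k: "length L = Suc k" using assms by (cases L) auto
  have last: "last L = L ! k" using assms k by (simp add: last_conv_nth)
  let ?A = "{j. Suc j < length L \<and> sgn (L ! j) \<noteq> sgn (L ! Suc j)}"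
  have "{j. Suc j < length (L @ [a]) \<and> sgn ((L @ [a]) ! j) \<noteq> sgn ((L @ [a]) ! Suc j)} =
      ?A \<union> (if sgn (last L) \<noteq> sgn a then {k} else {})"
    using k by (auto simp: nth_append last less_Suc_eq split: if_splits)
  moreover have "finite ?A" by (rule finite_subset[of _ "{..<length L}"]) auto
  moreover have "k \<notin> ?A" using k by simp
  ultimately show ?thesis by (simp add: sign_changes_def card_Un_disjoint)
qed

lemma sign_changes_off_diagonal:
  assumes "1 \<le> length ks"
  shows "diagonal_crossings ks =
    num_falls (weakly_above ks) 1 (length ks) + num_falls (\<lambda>i. \<not> weakly_above ks i) 1 (length ks)"
proof -
  define D where "D i = filter (\<lambda>d. d \<noteq> 0) [int (psum ks i) - int (i - 1), int (psum ks i) - int i]" for i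
  define O' where "O' j = concat (map D [1..<Suc j])" for j
  have off: "off_diagonal ks = O' (length ks)"
    unfolding off_diagonal_def diagram_def O'_def D_def by (simp add: map_concat filter_concat comp_def del: upt_Suc)
  have O'_Suc: "O' (Suc j) = O' j @ D (Suc j)" for j
    by (simp add: O'_def)
  let ?P = "weakly_above ks"
  \<comment> \<open>The two vertices of a step differ in height over the diagonal by one, so at
    least one is off it, and those off it share the sign given by \<open>weakly_above\<close>. Hence
    signs change only between steps.\<close>
  have D: "(if ?P (Suc j) then (\<exists>a>0. D (Suc j) = [a]) \<or> (\<exists>a>0. \<exists>b>0. D (Suc j) = [a, b])
     else (\<exists>a<0. D (Suc j) = [a]) \<or> (\<exists>a<0. \<exists>b<0. D (Suc j) = [a, b]))" for j
    by (auto simp: D_def weakly_above_def)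
  have "O' j \<noteq> [] \<and> sgn (last (O' j)) = (if ?P j then 1 else -1) \<and>
      sign_changes (O' j) = num_falls ?P 1 j + num_falls (\<lambda>i. \<not> ?P i) 1 j" if "1 \<le> j" for j
    using that
  proof (induction j rule: dec_induct)
    case base
    have "O' 1 = D (Suc 0)" by (simp add: O'_def)
    then show ?case
      using D[of 0] sign_changes_snoc[of "[_]"] by (auto split: if_splits)
  next
    case (step j)
    have 2: "sign_changes (O' j @ [a, b]) = sign_changes (O' j) + of_bool (sgn (last (O' j)) \<noteq> sgn a) + of_bool (sgn a \<noteq> sgn b)" for a b
      using sign_changes_snoc[of "O' j @ [a]" b] sign_changes_snoc[of "O' j" a] step.IH by simp
    show ?case
      using D[of j] step sign_changes_snoc[of "O' j"]
      by (auto simp: O'_Suc 2 num_falls_Suc split: if_splits)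
  qed
  then show ?thesis
    using assms unfolding off[symmetric] diagonal_crossings_def sign_changes_def
    by (metis off)
qed

text \<open>Starting and ending weakly above, the path has as many rises as falls. Only a fall at 1
  is not a crossing, as the origin has no side, so the crossings number 2x or 2x - 1.\<close>

lemma ceiling_half_diagonal_crossings:
  assumes "bloch_seq ks" "1 \<le> length ks"
  shows "\<lceil>of_nat (diagonal_crossings ks) / (2 :: rat)\<rceil> = int (num_falls (weakly_above ks) 0 (length ks))"
proof -
  let ?P = "weakly_above ks" and ?n = "length ks"
  define x where "x = num_falls ?P 0 ?n"
  have "num_falls (\<lambda>i. \<not> ?P i) 0 ?n = x"
    using num_falls_alternate[of ?P ?n] bloch_above_length(1)[OF assms(1)] by (simp add: x_def)
  then have "diagonal_crossings ks + of_bool (\<not> ?P 1) = 2 * x"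
    using sign_changes_off_diagonal[OF assms(2)] num_falls_from_1[OF assms(2), of ?P]
      num_falls_from_1[OF assms(2), of "\<lambda>i. \<not> ?P i"] by (simp add: x_def)
  then have "2 * (of_nat x :: rat) = of_nat (diagonal_crossings ks) + of_bool (\<not> ?P 1)"
    by (metis of_nat_add of_nat_mult of_nat_numeral of_nat_of_bool)
  then show ?thesis
    unfolding x_def[symmetric] by (intro ceiling_unique; cases "?P 1") auto
qed

theorem theorem3:
  shows "(\<forall>ks. bloch_seq ks \<and> length ks \<ge> 1 \<longrightarrow>
            bloch_c ks = t (\<Sum>i=1..num_blocks ks. lower_crossings ks i) \<and>
            bloch_e ks =
              (\<Sum>i=1..num_blocks ks.
                 (t (\<Sum>l=1..i. upper_crossings ks l) - t (\<Sum>l=1..i - 1. upper_crossings ks l)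
                    + kdelta i 1) *
                 t (\<Sum>j=i..num_blocks ks. lower_crossings ks j)))
       \<and> crossing_property_on {ks. bloch_seq ks \<and> length ks \<ge> 1} bloch_c
       \<and> (\<exists>h. \<forall>ks. bloch_seq ks \<longrightarrow> bloch_e ks = h (crossing_numbers ks))"
proof (intro conjI allI impI)
  fix ks assume "bloch_seq ks \<and> length ks \<ge> 1"
  then show "bloch_c ks = t (\<Sum>i=1..num_blocks ks. lower_crossings ks i)"
    using bloch_c_e_eq[of ks] crossing_numbers_sums(1)[of ks] by simp
next
  fix ks assume "bloch_seq ks \<and> length ks \<ge> 1"
  then show "bloch_e ks =
              (\<Sum>i=1..num_blocks ks.
                 (t (\<Sum>l=1..i. upper_crossings ks l) - t (\<Sum>l=1..i - 1. upper_crossings ks l)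
                    + kdelta i 1) *
                 t (\<Sum>j=i..num_blocks ks. lower_crossings ks j))"
    using bloch_c_e_eq[of ks] crossing_numbers_sums(2)[of ks] by simp
next
  show "crossing_property_on {ks. bloch_seq ks \<and> length ks \<ge> 1} bloch_c"
    unfolding crossing_property_on_def
    \<comment> \<open>The rounded half count is the number of falls of \<open>weakly_above\<close>,
      hence \<open>t\<close> composed with \<open>nat\<close>.\<close>
    by (rule exI[of _ "\<lambda>z. t (nat z)"]) (use bloch_c_e_eq ceiling_half_diagonal_crossings in auto)
next
  let ?h = "\<lambda>B. \<Sum>i=1..length B. (t (\<Sum>l=1..i. fst (B ! (l - 1))) - t (\<Sum>l=1..i - 1. fst (B ! (l - 1))) + kdelta i 1) *
                 t (\<Sum>j=i..length B. snd (B ! (j - 1)))"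
  \<comment> \<open>The empty sequence is included: the formula for \<open>bloch_e\<close> holds at
    length 0 too. In \<open>?h\<close>, \<open>l - 1\<close> converts block numbers to list
    positions.\<close>
  have "bloch_e ks = ?h (crossing_numbers ks)" if ks: "bloch_seq ks" for ks
  proof -
    have len: "length (crossing_numbers ks) = num_blocks ks"
      by (simp add: crossing_numbers_def del: upt_Suc)
    have nth: "crossing_numbers ks ! (l - 1) = (upper_crossings ks l, lower_crossings ks l)"
      if "1 \<le> l" "l \<le> num_blocks ks" for l
      using that by (cases l) (simp_all add: crossing_numbers_def del: upt_Suc)
    have N: "(\<Sum>l=1..i. fst (crossing_numbers ks ! (l - 1))) = (\<Sum>l=1..i. upper_crossings ks l)"
      if "i \<le> num_blocks ks" for i
      by (rule sum.cong) (use nth that in auto)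
    have n: "(\<Sum>l=i..num_blocks ks. snd (crossing_numbers ks ! (l - 1))) = (\<Sum>l=i..num_blocks ks. lower_crossings ks l)"
      if "1 \<le> i" for i
      by (rule sum.cong) (use nth that in auto)
    have "?h (crossing_numbers ks) = crossing_weight (weakly_above ks) (strictly_above ks) 0 (length ks)"
      unfolding crossing_numbers_sums(2)[OF ks] len
    proof (rule sum.cong)
      fix i assume "i \<in> {1..num_blocks ks}"
      then have "1 \<le> i" "i \<le> num_blocks ks" "i - 1 \<le> num_blocks ks" by auto
      then show "(t (\<Sum>l=1..i. fst (crossing_numbers ks ! (l - 1))) - t (\<Sum>l=1..i - 1. fst (crossing_numbers ks ! (l - 1))) + kdelta i 1) *
                 t (\<Sum>j=i..num_blocks ks. snd (crossing_numbers ks ! (j - 1))) =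
          (t (\<Sum>l=1..i. upper_crossings ks l) - t (\<Sum>l=1..i - 1. upper_crossings ks l) + kdelta i 1) *
                 t (\<Sum>j=i..num_blocks ks. lower_crossings ks j)"
        by (simp only: N n)
    qed simp
    then show ?thesis
      using bloch_c_e_eq[of ks] ks by simp
  qed
  then show "\<exists>h. \<forall>ks. bloch_seq ks \<longrightarrow> bloch_e ks = h (crossing_numbers ks)"
    by (intro exI[of _ ?h] allI impI)
qed

end
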